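(* The function $f:[0,1]^2\to\mathbb{R}$, $f(\alpha,\beta)=\sup_{u\in[-\ln2,\ln2]}W_2(u;\Lambda(\alpha,\beta))$, is uniformly continuous. If $\alpha=[0;a_0,a_1,\dots]$ and $\beta=[0;a_{-1},a_{-2},\dots]$ and $\Lambda=\Lambda(\alpha,\beta)$, then $$\ln\kappa_2(\Lambda)=\sup_{n}f(\alpha_{n-1}^{[a]},\beta_n^{[a]}),$$ the supremum being over all $n\in\mathbb{Z}$ for which $\alpha_{n-1}^{[a]}$ and $\beta_n^{[a]}$ are well-defined. Consequently the $\ell^2$ Mordell-Gruber spectrum $\mathrm{MGL}_2$ is closed.
   Context: A unimodular lattice in $\mathbb{R}^2$ is $\Lambda=\mathbb{Z}A+\mathbb{Z}B$ with $|\det(A;B)|=1$. Let $g_t=\mathrm{diag}(e^t,e^{-t})$. The $\ell^2$ Mordell constant is $\kappa_2(\Lambda)=\sup_{t\in\mathbb{R}}\sup\{r>0 : \{x^2+y^2<r^2\}\cap g_t\Lambda=\{(0,0)\}\}$, and $\mathrm{MGL}_2=\{\kappa_2(\Lambda):\Lambda\subset\mathbb{R}^2\text{ unimodular}\}$. The $\ell^2$ log-systole function is $W_2(t;\Lambda)=\ln\min_{A\in g_t\Lambda\setminus\{(0,0)\}}\|A\|_2$. For $\alpha,\beta\in[0,1]$, $\Lambda(\alpha,\beta)=\mathbb{Z}A+\mathbb{Z}B$ with $A=\frac{(-\alpha,1)}{\sqrt{1+\alpha\beta}}$, $B=\frac{(1,\beta)}{\sqrt{1+\alpha\beta}}$.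 Here $a$ is a two-sided sequence in $\mathbb{N}^+\cup\{\infty\}$ such that each of $(a_0,a_1,\dots)$ and $(a_{-1},a_{-2},\dots)$ either has all terms finite or has a first term equal to $\infty$ with no terms defined beyond it; $\alpha_n^{[a]}=[0;a_{n+1},a_{n+2},\dots]$, $\beta_n^{[a]}=[0;a_{n-1},a_{n-2},\dots]$ are continued fractions, $[0;s_1,s_2,\dots]=1/(s_1+1/(s_2+\cdots))$ with $1/\infty=0$. *)

theory Defs
  imports "HOL-Analysis.Analysis" "HOL-Library.Extended_Nat"
begin

definition lattice_of :: "real^2 \<Rightarrow> real^2 \<Rightarrow> (real^2) set" where
  "lattice_of A B = {of_int m *\<^sub>R A + of_int n *\<^sub>R B | m n :: int. True}"

definition unimodular_lattice :: "(real^2) set \<Rightarrow> bool" where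
  "unimodular_lattice L \<longleftrightarrow>
     (\<exists>A B. L = lattice_of A B \<and> \<bar>det (vector [A, B] :: real^2^2)\<bar> = 1)"

definition diag_flow :: "real \<Rightarrow> real^2^2" where
  "diag_flow t = vector [vector [exp t, 0], vector [0, exp (- t)]]"

abbreviation flow_lattice :: "real \<Rightarrow> (real^2) set \<Rightarrow> (real^2) set" where
  "flow_lattice t L \<equiv> (\<lambda>v. diag_flow t *v v) ` L"

text \<open>Both suprema are taken in the reals: for a unimodular lattice, the sets involved are
  nonempty (discreteness) and bounded above (Minkowski's theorem).\<close>

definition mordell_constant :: "(real^2) set \<Rightarrow> real" where
  "mordell_constant L =
     (SUP t. Sup {r. r > 0 \<and> {v. (v $ 1)\<^sup>2 + (v $ 2)\<^sup>2 < r\<^sup>2} \<inter> flow_lattice t L = {0}})"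

definition mordell_gruber_spectrum :: "real set" where
  "mordell_gruber_spectrum = mordell_constant ` {L. unimodular_lattice L}"

text \<open>The minimum is rendered by \<open>LEAST\<close>, which is the smallest element whenever one exists,
  as it does for a lattice.\<close>

definition log_systole :: "real \<Rightarrow> (real^2) set \<Rightarrow> real" where
  "log_systole t L = ln (LEAST \<rho>. \<rho> \<in> norm ` (flow_lattice t L - {0}))"

definition param_lattice :: "real \<Rightarrow> real \<Rightarrow> (real^2) set" where
  "param_lattice \<alpha> \<beta> =
     lattice_of ((1 / sqrt (1 + \<alpha> * \<beta>)) *\<^sub>R vector [- \<alpha>, 1])
                ((1 / sqrt (1 + \<alpha> * \<beta>)) *\<^sub>R vector [1, \<beta>])"

definition local_sup :: "real \<Rightarrow> real \<Rightarrow> real" where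
  "local_sup \<alpha> \<beta> = (SUP u\<in>{- ln 2..ln 2}. log_systole u (param_lattice \<alpha> \<beta>))"

text \<open>Partial quotients are indexed from 0, and \<open>None\<close> marks a term that is not defined.
  Either all terms are finite, or there is a term equal to \<open>\<infinity>\<close> beyond which nothing is defined.\<close>

definition cf_seq :: "(nat \<Rightarrow> enat option) \<Rightarrow> bool" where
  "cf_seq s \<longleftrightarrow>
     (\<forall>i. \<exists>k>0. s i = Some (enat k)) \<or>
     (\<exists>m. (\<forall>i<m. \<exists>k>0. s i = Some (enat k)) \<and> s m = Some \<infinity> \<and> (\<forall>i>m. s i = None))"

text \<open>Convergents of \<open>[0; s 0, s 1, \<dots>]\<close> with \<open>1 / \<infinity> = 0\<close>. The value at \<open>None\<close> is never
  reached from a sequence satisfying \<^const>\<open>cf_seq\<close>.\<close>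

fun cf_convergent :: "nat \<Rightarrow> (nat \<Rightarrow> enat option) \<Rightarrow> real" where
  "cf_convergent 0 s = 0"
| "cf_convergent (Suc m) s =
     (case s 0 of
        Some (enat k) \<Rightarrow> 1 / (real k + cf_convergent m (\<lambda>i. s (Suc i)))
      | Some \<infinity> \<Rightarrow> 0
      | None \<Rightarrow> 0)"

definition cf_value :: "(nat \<Rightarrow> enat option) \<Rightarrow> real" where
  "cf_value s = lim (\<lambda>m. cf_convergent m s)"

definition right_seq :: "(int \<Rightarrow> enat option) \<Rightarrow> int \<Rightarrow> nat \<Rightarrow> enat option" where
  "right_seq a n = (\<lambda>i. a (n + 1 + int i))"

definition left_seq :: "(int \<Rightarrow> enat option) \<Rightarrow> int \<Rightarrow> nat \<Rightarrow> enat option" where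
  "left_seq a n = (\<lambda>i. a (n - 1 - int i))"

definition alpha_cf :: "(int \<Rightarrow> enat option) \<Rightarrow> int \<Rightarrow> real" where
  "alpha_cf a n = cf_value (right_seq a n)"

definition beta_cf :: "(int \<Rightarrow> enat option) \<Rightarrow> int \<Rightarrow> real" where
  "beta_cf a n = cf_value (left_seq a n)"

end

theory Submission
  imports Defs
begin

text \<open>The Mordell constant of \<open>L\<close> is the supremum of the systole (the length of a shortest nonzero
  vector) along the orbit of \<open>L\<close> under the diagonal flow, so \<open>ln \<kappa>\<close> is the supremum of the log-systole
  \<open>W(t)\<close> over all times. Everything rests on three facts about systoles.

  The systole depends continuously on the basis (\<open>systole_change_of_basis\<close>): the coefficients of a
  lattice vector in a unimodular basis are bounded by its length, so short vectors move little when the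
  basis moves little. The bound is uniform over bounded sets of bases, hence over the window
  \<open>[- ln 2, ln 2]\<close> and over \<open>(\<alpha>, \<beta>) \<in> [0, 1]\<^sup>2\<close>, and \<open>local_sup\<close> inherits uniform continuity.

  A unimodular lattice has systole at least 1 at some time (\<open>exists_systole_ge_1\<close>), so \<open>\<kappa> \<ge> 1\<close> and times
  at which \<open>W(t) < 0\<close> are irrelevant for the supremum.

  Unimodular lattices whose systole is bounded below have bounded reduced bases
  (\<open>lattice_subsequence\<close>, Mahler's compactness criterion). This makes the spectrum closed
  directly: move lattices \<open>K\<^sub>k\<close> with \<open>\<kappa>(K\<^sub>k) \<longlonglongrightarrow> c\<close> along their orbits until the systole nearly attains
  \<open>\<kappa>(K\<^sub>k)\<close>, and pass to a limit lattice.

  For the formula, one step of the continued fraction algorithm,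
  \<open>(1 / (k + \<alpha>'), \<beta>) \<mapsto> (\<alpha>', 1 / (k + \<beta>))\<close>, moves the lattice along its orbit, up to a reflection, by the time
  \<open>\<tau> = ln ((k + \<alpha>') (k + \<beta>)) / 2\<close> (\<open>param_lattice_step\<close>). So all terms of the supremum are suprema of
  \<open>W\<close> over windows of radius \<open>ln 2\<close> centred at the successive reduction times of a single orbit, and none of them
  exceeds \<open>ln \<kappa>\<close>. Conversely, strictly between two windows, and beyond the last window of a
  terminating expansion, the basis vector \<open>A\<close> has length below 1, so \<open>W < 0\<close> there (\<open>log_systole_neg\<close>).
  Since \<open>W\<close> takes a nonnegative value somewhere, and necessarily inside a window, the windows suffice.
  Negative times follow by a quarter turn of the plane, which exchanges the two halves of the sequence.\<close>

section \<open>Planar lattices and their shortest vectors\<close>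

definition wedge :: "real^2 \<Rightarrow> real^2 \<Rightarrow> real" where
  "wedge v w = v $ 1 * w $ 2 - v $ 2 * w $ 1"

definition systole :: "(real^2) set \<Rightarrow> real" where
  "systole L = (LEAST \<rho>. \<rho> \<in> norm ` (L - {0}))"

lemma det_vector_eq_wedge: "det (vector [A, B] :: real^2^2) = wedge A B"
  by (simp add: det_2 wedge_def)

lemma norm_real2_squared: "(norm (v :: real^2))\<^sup>2 = (v $ 1)\<^sup>2 + (v $ 2)\<^sup>2"
  unfolding power2_norm_eq_inner by (simp add: inner_vec_def sum_2 power2_eq_square)

lemma lagrange_identity: "(wedge v w)\<^sup>2 + (v \<bullet> w)\<^sup>2 = (norm v)\<^sup>2 * (norm w)\<^sup>2"
  unfolding norm_real2_squared by (simp add: wedge_def inner_vec_def sum_2 algebra_simps power2_eq_square)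

lemma abs_wedge_le_norms: "\<bar>wedge v w\<bar> \<le> norm v * norm w"
proof -
  have "(wedge v w)\<^sup>2 \<le> (norm v * norm w)\<^sup>2"
    unfolding power_mult_distrib lagrange_identity[symmetric] by simp
  then show ?thesis
    by (simp add: abs_le_square_iff[symmetric])
qed

lemma wedge_combination:
  "wedge (a *\<^sub>R A + b *\<^sub>R B) (c *\<^sub>R A + d *\<^sub>R B) = (a * d - b * c) * wedge A B"
  by (simp add: wedge_def algebra_simps)

lemma lattice_memI: "of_int m *\<^sub>R A + of_int n *\<^sub>R B \<in> lattice_of A B"
  unfolding lattice_of_def by blast

lemma lattice_memE:
  assumes "v \<in> lattice_of A B"
  obtains m n :: int where "v = of_int m *\<^sub>R A + of_int n *\<^sub>R B"
  using assms unfolding lattice_of_def by blast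

lemma lattice_generators: "A \<in> lattice_of A B" "B \<in> lattice_of A B"
  using lattice_memI[of 1 A 0 B] lattice_memI[of 0 A 1 B] by simp_all

lemma zero_in_lattice: "0 \<in> lattice_of A B"
  using lattice_memI[of 0 A 0 B] by simp

lemma lattice_of_subset:
  assumes "A' \<in> lattice_of A B" "B' \<in> lattice_of A B"
  shows "lattice_of A' B' \<subseteq> lattice_of A B"
proof
  fix v assume "v \<in> lattice_of A' B'"
  then obtain m n :: int where v: "v = of_int m *\<^sub>R A' + of_int n *\<^sub>R B'" by (rule lattice_memE)
  obtain i j :: int where A': "A' = of_int i *\<^sub>R A + of_int j *\<^sub>R B" using assms(1) by (rule lattice_memE)
  obtain k l :: int where B': "B' = of_int k *\<^sub>R A + of_int l *\<^sub>R B" using assms(2) by (rule lattice_memE)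
  have "v = of_int (m * i + n * k) *\<^sub>R A + of_int (m * j + n * l) *\<^sub>R B"
    unfolding v A' B' by (simp add: algebra_simps)
  then show "v \<in> lattice_of A B" by (simp only: lattice_memI)
qed

lemma lattice_of_commute: "lattice_of B A = lattice_of A B"
  by (intro equalityI lattice_of_subset lattice_generators)

lemma lattice_of_minus: "lattice_of (- A) B = lattice_of A B"
proof (intro equalityI lattice_of_subset lattice_generators)
  show "- A \<in> lattice_of A B" using lattice_memI[of "-1" A 0 B] by simp
  show "A \<in> lattice_of (- A) B" using lattice_memI[of "-1" "- A" 0 B] by simp
qed

lemma lattice_of_shear: "lattice_of A (B + of_int k *\<^sub>R A) = lattice_of A B"
proof (intro equalityI lattice_of_subset lattice_generators)
  show "B + of_int k *\<^sub>R A \<in> lattice_of A B" using lattice_memI[of k A 1 B] by (simp add: add.commute)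
  show "B \<in> lattice_of A (B + of_int k *\<^sub>R A)"
    using lattice_memI[of "-k" A 1 "B + of_int k *\<^sub>R A"] by simp
qed

lemma linear_image_lattice_of:
  assumes "linear f"
  shows "f ` lattice_of A B = lattice_of (f A) (f B)"
proof -
  interpret linear f by fact
  have "f (of_int m *\<^sub>R A + of_int n *\<^sub>R B) = of_int m *\<^sub>R f A + of_int n *\<^sub>R f B" for m n
    by (simp add: add scale)
  then show ?thesis
    unfolding lattice_of_def by (force simp: image_iff)
qed

lemma unimodular_latticeI: "\<bar>wedge A B\<bar> = 1 \<Longrightarrow> unimodular_lattice (lattice_of A B)"
  unfolding unimodular_lattice_def det_vector_eq_wedge by blast

lemma unimodular_latticeE:
  assumes "unimodular_lattice L"
  obtains A B where "L = lattice_of A B" "\<bar>wedge A B\<bar> = 1"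
  using assms unfolding unimodular_lattice_def det_vector_eq_wedge by blast

text \<open>The coefficients of \<open>v\<close> in a unimodular basis are, up to sign, the wedge products of \<open>v\<close>
  with the basis vectors (Cramer's rule); this is what makes the lattice discrete, and also what
  controls how \<open>v\<close> moves when the basis is perturbed.\<close>

lemma coefficient_bounds:
  assumes "\<bar>wedge A B\<bar> = 1" and v: "v = of_int m *\<^sub>R A + of_int n *\<^sub>R B"
  shows "\<bar>real_of_int m\<bar> \<le> norm v * norm B" "\<bar>real_of_int n\<bar> \<le> norm v * norm A"
proof -
  have "wedge v B = of_int m * wedge A B" "wedge v A = - of_int n * wedge A B"
    unfolding v by (simp_all add: wedge_def algebra_simps)
  then have "\<bar>wedge v B\<bar> = \<bar>of_int m\<bar>" "\<bar>wedge v A\<bar> = \<bar>of_int n\<bar>"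
    using assms(1) by (simp_all add: abs_mult)
  then show "\<bar>real_of_int m\<bar> \<le> norm v * norm B" "\<bar>real_of_int n\<bar> \<le> norm v * norm A"
    using abs_wedge_le_norms[of v B] abs_wedge_le_norms[of v A] by simp_all
qed

lemma finite_lattice_ball:
  assumes "unimodular_lattice L"
  shows "finite {v \<in> L. norm v \<le> R}"
proof -
  obtain A B where L: "L = lattice_of A B" and AB: "\<bar>wedge A B\<bar> = 1"
    using assms by (rule unimodular_latticeE)
  define M where "M = \<lceil>R * (norm A + norm B)\<rceil>"
  have "{v \<in> L. norm v \<le> R} \<subseteq>
      (\<lambda>(m, n). of_int m *\<^sub>R A + of_int n *\<^sub>R B) ` ({- M..M} \<times> {- M..M})"
  proof
    fix v assume "v \<in> {v \<in> L. norm v \<le> R}"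
    then have "v \<in> lattice_of A B" and R: "norm v \<le> R" by (auto simp: L)
    from this(1) obtain m n where v: "v = of_int m *\<^sub>R A + of_int n *\<^sub>R B" by (rule lattice_memE)
    have "R \<ge> 0" using R norm_ge_zero[of v] by linarith
    then have "norm v * norm B \<le> R * (norm A + norm B)" "norm v * norm A \<le> R * (norm A + norm B)"
      using R by (auto intro!: mult_mono)
    with coefficient_bounds[OF AB v]
    have "\<bar>real_of_int m\<bar> \<le> R * (norm A + norm B)" "\<bar>real_of_int n\<bar> \<le> R * (norm A + norm B)"
      by linarith+
    then have "\<bar>m\<bar> \<le> M" "\<bar>n\<bar> \<le> M" unfolding M_def by linarith+
    then show "v \<in> (\<lambda>(m, n). of_int m *\<^sub>R A + of_int n *\<^sub>R B) ` ({- M..M} \<times> {- M..M})"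
      unfolding v by force
  qed
  then show ?thesis by (rule finite_subset) auto
qed

lemma systole_attained_and_minimal:
  assumes "unimodular_lattice L"
  shows "\<exists>v\<in>L - {0}. norm v = systole L \<and> (\<forall>w\<in>L - {0}. systole L \<le> norm w)"
proof -
  obtain A B where L: "L = lattice_of A B" and AB: "\<bar>wedge A B\<bar> = 1"
    using assms by (rule unimodular_latticeE)
  have "A \<noteq> 0" using AB by (auto simp: wedge_def)
  define S where "S = {v \<in> L. norm v \<le> norm A} - {0}"
  have S: "finite S" "A \<in> S"
    using finite_lattice_ball[OF assms] \<open>A \<noteq> 0\<close> by (auto simp: S_def L lattice_generators)
  define v where "v = arg_min_on norm S"
  have v: "v \<in> S" "\<And>w. w \<in> S \<Longrightarrow> norm v \<le> norm w"
    using arg_min_if_finite(1)[OF S(1), of norm] arg_min_least[OF S(1), of _ norm] S(2)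
    by (auto simp: v_def)
  have vL: "v \<in> L - {0}" using v(1) by (auto simp: S_def)
  have min: "norm v \<le> norm w" if "w \<in> L - {0}" for w
    using v(2)[of w] v(2)[OF S(2)] that by (cases "norm w \<le> norm A") (auto simp: S_def)
  have "systole L = norm v"
    unfolding systole_def by (rule Least_equality) (use vL min in auto)
  then show ?thesis using vL min by metis
qed

lemma systole_attained:
  assumes "unimodular_lattice L"
  obtains v where "v \<in> L" "v \<noteq> 0" "norm v = systole L"
  using systole_attained_and_minimal[OF assms] by blast

lemma systole_le: "unimodular_lattice L \<Longrightarrow> v \<in> L \<Longrightarrow> v \<noteq> 0 \<Longrightarrow> systole L \<le> norm v"
  using systole_attained_and_minimal by blast

lemma systole_pos: "unimodular_lattice L \<Longrightarrow> systole L > 0"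
  by (metis systole_attained zero_less_norm_iff)

text \<open>A lattice vector with fixed coefficients moves, under a change of basis, by at most the
  displacement of the basis times its coefficients, and the coefficients are bounded by its own
  length. So the systole changes by a factor close to 1.\<close>

lemma systole_change_of_basis:
  assumes AB: "\<bar>wedge A B\<bar> = 1" and AB': "\<bar>wedge A' B'\<bar> = 1"
  shows "systole (lattice_of A' B') \<le>
    systole (lattice_of A B) * (1 + norm B * norm (A' - A) + norm A * norm (B' - B))"
proof -
  obtain v where v: "v \<in> lattice_of A B" "v \<noteq> 0" "norm v = systole (lattice_of A B)"
    using systole_attained[OF unimodular_latticeI[OF AB]] .
  obtain m n where mn: "v = of_int m *\<^sub>R A + of_int n *\<^sub>R B" using v(1) by (rule lattice_memE)
  define v' where "v' = of_int m *\<^sub>R A' + of_int n *\<^sub>R B'"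
  have "v' \<noteq> 0"
  proof
    assume "v' = 0"
    then have "m = 0" "n = 0" using coefficient_bounds[OF AB' v'_def] by auto
    with mn v(2) show False by simp
  qed
  have "v' = v + (of_int m *\<^sub>R (A' - A) + of_int n *\<^sub>R (B' - B))"
    by (simp add: v'_def mn algebra_simps)
  then have "norm v' \<le> norm v + norm (of_int m *\<^sub>R (A' - A) + of_int n *\<^sub>R (B' - B))"
    by (simp only: norm_triangle_ineq)
  also have "\<dots> \<le> norm v + (norm (of_int m *\<^sub>R (A' - A)) + norm (of_int n *\<^sub>R (B' - B)))"
    by (intro add_left_mono norm_triangle_ineq)
  also have "\<dots> \<le> norm v + ((norm v * norm B) * norm (A' - A) + (norm v * norm A) * norm (B' - B))"
    using coefficient_bounds[OF AB mn] by (intro add_left_mono add_mono) (auto intro!: mult_right_mono)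
  also have "\<dots> = norm v * (1 + norm B * norm (A' - A) + norm A * norm (B' - B))"
    by (simp add: algebra_simps)
  finally show ?thesis
    using systole_le[OF unimodular_latticeI[OF AB'] _ \<open>v' \<noteq> 0\<close>] v(3)
    by (force simp: v'_def lattice_memI)
qed

lemma ln_systole_change_of_basis:
  assumes AB: "\<bar>wedge A B\<bar> = 1" and AB': "\<bar>wedge A' B'\<bar> = 1"
    and R: "norm A \<le> R" "norm B \<le> R"
  shows "ln (systole (lattice_of A' B')) \<le>
    ln (systole (lattice_of A B)) + R * (norm (A' - A) + norm (B' - B))"
proof -
  let ?x = "norm B * norm (A' - A) + norm A * norm (B' - B)"
  have pos: "systole (lattice_of A' B') > 0" "systole (lattice_of A B) > 0"
    by (simp_all add: systole_pos unimodular_latticeI AB AB')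
  have x: "?x \<ge> 0" by simp
  have "ln (systole (lattice_of A' B')) \<le> ln (systole (lattice_of A B) * (1 + ?x))"
    using systole_change_of_basis[OF AB AB'] pos x by (simp add: algebra_simps)
  also have "\<dots> = ln (systole (lattice_of A B)) + ln (1 + ?x)"
    using pos x by (intro ln_mult_pos) linarith+
  also have "ln (1 + ?x) \<le> ?x" using x by (rule ln_add_one_self_le_self)
  also have "?x \<le> R * norm (A' - A) + R * norm (B' - B)"
    using R by (intro add_mono mult_right_mono) auto
  finally show ?thesis by (simp add: algebra_simps)
qed

text \<open>Gauss reduction: a basis minimizing the sum of the lengths cannot be shortened by adding one
  vector to the other, so its vectors are nearly orthogonal.\<close>

lemma reduced_basis:
  assumes "unimodular_lattice L"
  obtains C D where "L = lattice_of C D" "\<bar>wedge C D\<bar> = 1" "norm C \<le> norm D"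
    "2 * \<bar>C \<bullet> D\<bar> \<le> (norm C)\<^sup>2"
proof -
  obtain A B where L: "L = lattice_of A B" and AB: "\<bar>wedge A B\<bar> = 1"
    using assms by (rule unimodular_latticeE)
  define R where "R = norm A + norm B"
  define S where "S = {(C, D). L = lattice_of C D \<and> \<bar>wedge C D\<bar> = 1 \<and> norm C \<le> norm D \<and> norm C + norm D \<le> R}"
  have "S \<subseteq> {v \<in> L. norm v \<le> R} \<times> {v \<in> L. norm v \<le> R}"
    unfolding S_def using lattice_generators norm_ge_zero by (force intro: order_trans[rotated])
  then have fin: "finite S"
    by (rule finite_subset) (simp add: finite_lattice_ball[OF assms])
  have swap: "\<bar>wedge D C\<bar> = \<bar>wedge C D\<bar>" for C D by (simp add: wedge_def algebra_simps abs_minus_commute)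
  have in_S: "(C, D) \<in> S \<or> (D, C) \<in> S"
    if "L = lattice_of C D" "\<bar>wedge C D\<bar> = 1" "norm C + norm D \<le> R" for C D
    using that swap[of C D] lattice_of_commute[of C D] unfolding S_def by (auto simp: add.commute)
  have "(A, B) \<in> S \<or> (B, A) \<in> S" by (rule in_S) (simp_all add: L AB R_def)
  then have ne: "S \<noteq> {}" by blast
  define f where "f = (\<lambda>(C :: real^2, D :: real^2). norm C + norm D)"
  have "Min (f ` S) \<in> f ` S" using fin ne by simp
  then obtain C D where CD: "(C, D) \<in> S" and "Min (f ` S) = f (C, D)" by (metis imageE surj_pair)
  then have min: "\<And>p. p \<in> S \<Longrightarrow> f (C, D) \<le> f p" using fin by (metis Min_le finite_imageI imageI)
  have CD': "L = lattice_of C D" "\<bar>wedge C D\<bar> = 1" "norm C \<le> norm D" "norm C + norm D \<le> R"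
    using CD by (auto simp: S_def)
  have no_shear: "norm D \<le> norm (D + of_int k *\<^sub>R C)" for k
  proof (rule ccontr)
    assume less: "\<not> ?thesis"
    have "wedge C (D + of_int k *\<^sub>R C) = wedge C D" by (simp add: wedge_def algebra_simps)
    then have "(C, D + of_int k *\<^sub>R C) \<in> S \<or> (D + of_int k *\<^sub>R C, C) \<in> S"
      using CD' less by (intro in_S) (simp_all add: lattice_of_shear)
    then show False using min less by (force simp: f_def)
  qed
  have "2 * \<bar>C \<bullet> D\<bar> \<le> (norm C)\<^sup>2"
  proof -
    have "(norm D)\<^sup>2 \<le> (norm (D + of_int k *\<^sub>R C))\<^sup>2" for k
      using no_shear[of k] by (simp add: power_mono)
    then have "(norm D)\<^sup>2 \<le> (norm D)\<^sup>2 + 2 * k * (C \<bullet> D) + k\<^sup>2 * (norm C)\<^sup>2" for k :: int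
      unfolding power2_norm_eq_inner
      by (simp add: algebra_simps inner_commute power2_eq_square)
    from this[of 1] this[of "-1"] show ?thesis by simp
  qed
  with CD' show ?thesis using that by blast
qed

lemma reduced_basis_bounds:
  assumes "\<bar>wedge C D\<bar> = 1" "norm C \<le> norm D" "2 * \<bar>C \<bullet> D\<bar> \<le> (norm C)\<^sup>2"
  shows "norm C \<le> 2" "norm C * norm D \<le> 2"
proof -
  have C: "0 \<le> (norm C)\<^sup>2" "(norm C)\<^sup>2 \<le> (norm D)\<^sup>2" using assms(2) by (simp_all add: power_mono)
  have "(2 * \<bar>C \<bullet> D\<bar>)\<^sup>2 \<le> ((norm C)\<^sup>2)\<^sup>2" using assms(3) by (intro power_mono) auto
  then have "4 * (C \<bullet> D)\<^sup>2 \<le> (norm C)\<^sup>2 * (norm C)\<^sup>2" by (simp add: power2_eq_square)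
  also have "\<dots> \<le> (norm C)\<^sup>2 * (norm D)\<^sup>2" using C by (intro mult_left_mono)
  finally have *: "4 * (C \<bullet> D)\<^sup>2 \<le> (norm C)\<^sup>2 * (norm D)\<^sup>2" .
  have "(wedge C D)\<^sup>2 = 1" using assms(1) by (metis power2_abs one_power2)
  with lagrange_identity[of C D] * have 3: "(norm C)\<^sup>2 * (norm D)\<^sup>2 \<le> 2\<^sup>2" by simp
  then show CD: "norm C * norm D \<le> 2" by (metis power_mult_distrib power2_le_imp_le zero_le_numeral)
  have "norm C * norm C \<le> norm C * norm D" using assms(2) by (intro mult_left_mono) auto
  then have "(norm C)\<^sup>2 \<le> 2\<^sup>2" using CD by (simp add: power2_eq_square)
  then show "norm C \<le> 2" by (rule power2_le_imp_le) simp
qed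

lemma systole_le_2:
  assumes "unimodular_lattice L"
  shows "systole L \<le> 2"
proof -
  obtain C D where CD: "L = lattice_of C D" "\<bar>wedge C D\<bar> = 1" "norm C \<le> norm D"
    "2 * \<bar>C \<bullet> D\<bar> \<le> (norm C)\<^sup>2" using reduced_basis[OF assms] .
  have "C \<noteq> 0" using CD(2) by (auto simp: wedge_def)
  with systole_le[OF assms, of C] reduced_basis_bounds[OF CD(2-4)] show ?thesis
    by (simp add: CD(1) lattice_generators)
qed


section \<open>The diagonal flow and the Mordell constant\<close>

lemma diag_flow_nth [simp]:
  "(diag_flow t *v v) $ 1 = exp t * v $ 1" "(diag_flow t *v v) $ 2 = exp (- t) * v $ 2"
  by (simp_all add: diag_flow_def matrix_vector_mult_def sum_2)

lemma vec2_eqI: "v $ 1 = w $ 1 \<Longrightarrow> v $ 2 = w $ 2 \<Longrightarrow> v = (w :: real^2)"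
  by (simp add: vec_eq_iff forall_2)

lemma wedge_flow [simp]: "wedge (diag_flow t *v v) (diag_flow t *v w) = wedge v w"
  by (simp add: wedge_def exp_minus field_simps)

lemma flow_lattice_of:
  "flow_lattice t (lattice_of A B) = lattice_of (diag_flow t *v A) (diag_flow t *v B)"
  by (rule linear_image_lattice_of) simp

lemma unimodular_flow: "unimodular_lattice L \<Longrightarrow> unimodular_lattice (flow_lattice t L)"
  by (metis flow_lattice_of unimodular_latticeE unimodular_latticeI wedge_flow)

lemma flow_flow: "flow_lattice s (flow_lattice t L) = flow_lattice (s + t) L"
proof -
  have "diag_flow s *v (diag_flow t *v v) = diag_flow (s + t) *v v" for v
    by (rule vec2_eqI) (simp_all add: exp_add[symmetric] algebra_simps flip: mult.assoc)
  then show ?thesis by (simp add: image_image)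
qed

lemma flow_0: "flow_lattice 0 L = L"
proof -
  have "diag_flow 0 *v v = v" for v by (rule vec2_eqI) simp_all
  then show ?thesis by simp
qed

lemma norm_flow_squared:
  "(norm (diag_flow t *v v))\<^sup>2 = (exp t)\<^sup>2 * (v $ 1)\<^sup>2 + (exp (- t))\<^sup>2 * (v $ 2)\<^sup>2"
  by (simp add: norm_real2_squared power_mult_distrib)

lemma norm_flow_le: "norm (diag_flow t *v v) \<le> exp \<bar>t\<bar> * norm v"
proof -
  have "(norm (diag_flow t *v v))\<^sup>2 \<le> (exp \<bar>t\<bar>)\<^sup>2 * (v $ 1)\<^sup>2 + (exp \<bar>t\<bar>)\<^sup>2 * (v $ 2)\<^sup>2"
    unfolding norm_flow_squared by (intro add_mono mult_right_mono power_mono) auto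
  also have "\<dots> = (exp \<bar>t\<bar> * norm v)\<^sup>2"
    by (simp add: power_mult_distrib norm_real2_squared algebra_simps)
  finally show ?thesis by (rule power2_le_imp_le) simp
qed

lemma log_systole_eq: "log_systole t L = ln (systole (flow_lattice t L))"
  by (simp add: log_systole_def systole_def)

lemma log_systole_flow: "log_systole s (flow_lattice t L) = log_systole (s + t) L"
  by (simp add: log_systole_eq flow_flow)

lemma log_systole_le_ln_2: "unimodular_lattice L \<Longrightarrow> log_systole t L \<le> ln 2"
  using systole_le_2[OF unimodular_flow] systole_pos[OF unimodular_flow] by (simp add: log_systole_eq)

lemma bdd_above_log_systole: "unimodular_lattice L \<Longrightarrow> bdd_above ((\<lambda>t. log_systole t L) ` T)"
  using log_systole_le_ln_2 by (intro bdd_aboveI2) blast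

lemma log_systole_le_ln_norm:
  "unimodular_lattice L \<Longrightarrow> v \<in> L \<Longrightarrow> v \<noteq> 0 \<Longrightarrow> log_systole t L \<le> ln (norm (diag_flow t *v v))"
proof -
  assume L: "unimodular_lattice L" and v: "v \<in> L" "v \<noteq> 0"
  have "diag_flow t *v v \<noteq> 0"
    using v(2) by (auto simp: vec_eq_iff forall_2)
  with v systole_le[OF unimodular_flow[OF L]] have "systole (flow_lattice t L) \<le> norm (diag_flow t *v v)"
    by blast
  then show "log_systole t L \<le> ln (norm (diag_flow t *v v))"
    unfolding log_systole_eq using systole_pos[OF unimodular_flow[OF L], of t] by (intro ln_mono) simp_all
qed

text \<open>The admissible radii form the interval \<open>(0, systole L]\<close>, so that the inner supremum in the definition of
  the Mordell constant is the systole.\<close>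

lemma Sup_empty_disc_eq_systole:
  assumes "unimodular_lattice L"
  shows "Sup {r. r > 0 \<and> {v. (v $ 1)\<^sup>2 + (v $ 2)\<^sup>2 < r\<^sup>2} \<inter> L = {0}} = systole L"
proof -
  have disc: "{v :: real^2. (v $ 1)\<^sup>2 + (v $ 2)\<^sup>2 < r\<^sup>2} = {v. norm v < r}" if "r > 0" for r
    using that by (auto simp: norm_real2_squared[symmetric] power_strict_mono intro: power2_less_imp_less)
  have "0 \<in> L" using assms unimodular_latticeE zero_in_lattice by metis
  then have "({v. norm v < r} \<inter> L = {0}) = (\<forall>v\<in>L - {0}. r \<le> norm v)" if "r > 0" for r
    using that by (force simp: not_less)
  also have "(\<forall>v\<in>L - {0}. r \<le> norm v) = (r \<le> systole L)" for r
    using systole_attained_and_minimal[OF assms] by (metis order_trans)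
  finally have "r > 0 \<and> {v. (v $ 1)\<^sup>2 + (v $ 2)\<^sup>2 < r\<^sup>2} \<inter> L = {0} \<longleftrightarrow> r \<in> {0<..systole L}" for r
    using disc[of r] by (cases "r > 0") simp_all
  then have "{r. r > 0 \<and> {v. (v $ 1)\<^sup>2 + (v $ 2)\<^sup>2 < r\<^sup>2} \<inter> L = {0}} = {0<..systole L}"
    by blast
  then show ?thesis using systole_pos[OF assms] by simp
qed

lemma mordell_constant_eq_SUP:
  "unimodular_lattice L \<Longrightarrow> mordell_constant L = (SUP t. systole (flow_lattice t L))"
  unfolding mordell_constant_def by (simp add: Sup_empty_disc_eq_systole unimodular_flow)

lemma bdd_above_systole: "unimodular_lattice L \<Longrightarrow> bdd_above (range (\<lambda>t. systole (flow_lattice t L)))"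
  using systole_le_2 unimodular_flow by (intro bdd_aboveI2) blast

lemma systole_le_mordell: "unimodular_lattice L \<Longrightarrow> systole (flow_lattice t L) \<le> mordell_constant L"
  unfolding mordell_constant_eq_SUP by (rule cSUP_upper[OF UNIV_I bdd_above_systole])

lemma mordell_le: "unimodular_lattice L \<Longrightarrow> (\<And>t. systole (flow_lattice t L) \<le> c) \<Longrightarrow> mordell_constant L \<le> c"
  unfolding mordell_constant_eq_SUP by (rule cSUP_least[OF UNIV_not_empty])

lemma log_systole_le_ln_mordell: "unimodular_lattice L \<Longrightarrow> log_systole t L \<le> ln (mordell_constant L)"
  unfolding log_systole_eq using systole_le_mordell systole_pos[OF unimodular_flow] by (intro ln_mono) blast+

text \<open>A lattice all of whose deformations had systole below 1 is impossible. Follow a shortest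
  vector \<open>v\<close> of \<open>L\<close> along the flow: it is eventually stretched, so at some time its length is exactly 1.
  A lattice vector that is shorter than 1 at that time spans with \<open>v\<close> an area below 1, which for integral
  coordinates means area 0; hence it is parallel to \<open>v\<close>, and it would have been shorter than \<open>v\<close>
  from the start.\<close>

lemma exists_systole_ge_1:
  assumes "unimodular_lattice L"
  shows "\<exists>t. systole (flow_lattice t L) \<ge> 1"
proof (cases "systole L \<ge> 1")
  case True
  then show ?thesis by (intro exI[of _ 0]) (simp add: flow_0)
next
  case False
  obtain A B where L: "L = lattice_of A B" and AB: "\<bar>wedge A B\<bar> = 1"
    using assms by (rule unimodular_latticeE)
  obtain v where v: "v \<in> L" "v \<noteq> 0" "norm v = systole L" using systole_attained[OF assms] .
  define h where "h = (\<lambda>t. (norm (diag_flow t *v v))\<^sup>2)"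
  have h: "h t = (exp t)\<^sup>2 * (v $ 1)\<^sup>2 + (exp (- t))\<^sup>2 * (v $ 2)\<^sup>2" for t
    by (simp add: h_def norm_flow_squared)
  have cont: "isCont h t" for t unfolding h by (intro continuous_intros)
  have h0: "h 0 \<le> 1"
    using False v(3) power_le_one[of "systole L" 2] systole_pos[OF assms]
    by (simp add: h norm_real2_squared[symmetric])
  \<comment> \<open>Since \<open>exp s \<ge> s\<close>, by time \<open>s = 1 / \<bar>x\<bar>\<close> a nonzero coordinate \<open>x\<close> has been stretched to at least 1.\<close>
  obtain T where T: "h T = 1"
  proof (cases "v $ 1 = 0")
    case False
    define s where "s = \<bar>inverse (v $ 1)\<bar>"
    have "0 \<le> s" "s \<le> exp s" using exp_ge_add_one_self[of s] by (simp add: s_def, linarith)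
    have "1 = s\<^sup>2 * (v $ 1)\<^sup>2" using False by (simp add: s_def power_inverse)
    also have "\<dots> \<le> (exp s)\<^sup>2 * (v $ 1)\<^sup>2"
      using \<open>0 \<le> s\<close> \<open>s \<le> exp s\<close> by (intro mult_right_mono power_mono) simp_all
    also have "\<dots> \<le> h s" by (simp add: h)
    finally show ?thesis using IVT[of h 0 1 s] h0 cont that by (auto simp: s_def)
  next
    case True
    then have nz: "v $ 2 \<noteq> 0" using v(2) vec2_eqI[of v 0] by auto
    define s where "s = \<bar>inverse (v $ 2)\<bar>"
    have "0 \<le> s" "s \<le> exp s" using exp_ge_add_one_self[of s] by (simp add: s_def, linarith)
    have "1 = s\<^sup>2 * (v $ 2)\<^sup>2" using nz by (simp add: s_def power_inverse)
    also have "\<dots> \<le> (exp (- (- s)))\<^sup>2 * (v $ 2)\<^sup>2"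
      using \<open>0 \<le> s\<close> \<open>s \<le> exp s\<close> by (intro mult_right_mono power_mono) simp_all
    also have "\<dots> \<le> h (- s)" by (simp add: h)
    finally show ?thesis using IVT2[of h 0 1 "- s"] h0 cont that by (auto simp: s_def)
  qed
  have "norm (diag_flow T *v v) = 1"
    using T by (simp add: h_def power2_eq_1_iff) (use norm_ge_zero[of "diag_flow T *v v"] in linarith)
  moreover
  have "1 \<le> norm (diag_flow T *v w)" if w: "w \<in> L" "w \<noteq> 0" for w
  proof (rule ccontr)
    assume short: "\<not> ?thesis"
    have "\<bar>wedge v w\<bar> < 1"
      using abs_wedge_le_norms[of "diag_flow T *v v" "diag_flow T *v w"] short calculation by simp
    moreover have "\<exists>k :: int. \<bar>wedge v w\<bar> = \<bar>of_int k\<bar>"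
    proof -
      obtain i j :: int where "v = of_int i *\<^sub>R A + of_int j *\<^sub>R B" using v(1) L by (auto elim: lattice_memE)
      moreover obtain k l :: int where "w = of_int k *\<^sub>R A + of_int l *\<^sub>R B" using w(1) L by (auto elim: lattice_memE)
      ultimately have "wedge v w = of_int (i * l - j * k) * wedge A B"
        by (simp add: wedge_combination)
      then show ?thesis using AB by (metis abs_mult mult.right_neutral)
    qed
    ultimately have "wedge v w = 0" by force
    obtain q where q: "w = q *\<^sub>R v"
    proof -
      have e: "v $ 1 * w $ 2 = v $ 2 * w $ 1" using \<open>wedge v w = 0\<close> by (simp add: wedge_def)
      consider "v $ 1 \<noteq> 0" | "v $ 2 \<noteq> 0" using v(2) vec2_eqI[of v 0] by auto
      then show ?thesis
      proof cases
        case 1 then show ?thesis using e by (intro that[of "w $ 1 / v $ 1"] vec2_eqI) (simp_all add: field_simps)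
      next
        case 2 then show ?thesis using e by (intro that[of "w $ 2 / v $ 2"] vec2_eqI) (simp_all add: field_simps)
      qed
    qed
    have "norm v \<le> \<bar>q\<bar> * norm v" using systole_le[OF assms w] v(3) q by simp
    then have "\<bar>q\<bar> \<ge> 1" using v(2) by simp
    moreover have "norm (diag_flow T *v w) = \<bar>q\<bar>"
      using \<open>norm (diag_flow T *v v) = 1\<close> by (simp add: q matrix_vector_mult_scaleR)
    ultimately show False using short by simp
  qed
  moreover obtain u where "u \<in> flow_lattice T L" "u \<noteq> 0" "norm u = systole (flow_lattice T L)"
    using systole_attained[OF unimodular_flow[OF assms]] .
  ultimately show ?thesis by (intro exI[of _ T]) force
qed

lemma mordell_ge_1: "unimodular_lattice L \<Longrightarrow> mordell_constant L \<ge> 1"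
  using exists_systole_ge_1 systole_le_mordell order_trans by blast

lemma exists_log_systole_nonneg: "unimodular_lattice L \<Longrightarrow> \<exists>t. log_systole t L \<ge> 0"
  unfolding log_systole_eq using exists_systole_ge_1 ln_ge_zero by blast

lemma ln_mordell_le:
  assumes L: "unimodular_lattice L" and "\<And>t. log_systole t L \<le> c"
  shows "ln (mordell_constant L) \<le> c"
proof -
  have "systole (flow_lattice t L) \<le> exp c" for t
    using assms(2)[of t] systole_pos[OF unimodular_flow[OF L], of t] unfolding log_systole_eq
    by (simp flip: ln_le_cancel_iff)
  then have "mordell_constant L \<le> exp c" using mordell_le[OF L] by blast
  moreover have "mordell_constant L > 0" using mordell_ge_1[OF L] by linarith
  ultimately show ?thesis using ln_mono[of "mordell_constant L" "exp c"] by simp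
qed

lemma mordell_reparametrize:
  assumes "unimodular_lattice L" "unimodular_lattice L'" "surj h"
    and "\<And>t. systole (flow_lattice t L') = systole (flow_lattice (h t) L)"
  shows "mordell_constant L' = mordell_constant L"
proof -
  have "range (\<lambda>t. systole (flow_lattice t L')) = (\<lambda>t. systole (flow_lattice t L)) ` range h"
    by (simp add: assms(4) image_image)
  then show ?thesis using assms by (simp add: mordell_constant_eq_SUP)
qed

lemma mordell_flow: "unimodular_lattice L \<Longrightarrow> mordell_constant (flow_lattice s L) = mordell_constant L"
  by (rule mordell_reparametrize[where h = "\<lambda>t. t + s"])
    (auto simp: unimodular_flow flow_flow intro!: surjI[of _ "\<lambda>t. t - s"])

section \<open>Closedness of the spectrum\<close>

lemma tendsto_systole:
  assumes "\<And>k. \<bar>wedge (A k) (B k)\<bar> = 1" "\<bar>wedge C D\<bar> = 1"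
    and A: "A \<longlonglongrightarrow> C" and B: "B \<longlonglongrightarrow> D"
  shows "(\<lambda>k. systole (lattice_of (A k) (B k))) \<longlonglongrightarrow> systole (lattice_of C D)"
proof -
  let ?\<sigma> = "systole (lattice_of C D)"
  let ?\<sigma>k = "\<lambda>k. systole (lattice_of (A k) (B k))"
  let ?x = "\<lambda>k. 1 + norm (B k) * norm (C - A k) + norm (A k) * norm (D - B k)"
  let ?y = "\<lambda>k. 1 + norm D * norm (A k - C) + norm C * norm (B k - D)"
  have "?x \<longlonglongrightarrow> 1 + norm D * norm (C - C) + norm C * norm (D - D)"
    by (intro tendsto_intros A B)
  then have x: "?x \<longlonglongrightarrow> 1" by simp
  have "?y \<longlonglongrightarrow> 1 + norm D * norm (C - C) + norm C * norm (D - D)"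
    by (intro tendsto_intros A B)
  then have y: "?y \<longlonglongrightarrow> 1" by simp
  have xpos: "?x k > 0" for k
    using add_pos_nonneg[of "1::real" "norm (B k) * norm (C - A k) + norm (A k) * norm (D - B k)"] by (simp add: add.assoc)
  show ?thesis
  proof (rule tendsto_sandwich)
    show "\<forall>\<^sub>F k in sequentially. ?\<sigma> / ?x k \<le> ?\<sigma>k k"
      using systole_change_of_basis[OF assms(1) assms(2)] xpos by (simp add: divide_le_eq)
    show "\<forall>\<^sub>F k in sequentially. ?\<sigma>k k \<le> ?\<sigma> * ?y k"
      using systole_change_of_basis[OF assms(2) assms(1)] by simp
    show "(\<lambda>k. ?\<sigma> / ?x k) \<longlonglongrightarrow> ?\<sigma>" using tendsto_divide[OF tendsto_const x] by simp
    show "(\<lambda>k. ?\<sigma> * ?y k) \<longlonglongrightarrow> ?\<sigma>" using tendsto_mult[OF tendsto_const y] by simp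
  qed
qed

text \<open>In a reduced basis the product of the lengths is at most 2, and the first vector is no shorter than
  the systole; so a lower bound on the systole confines the reduced bases to a compact set. The bound \<open>1 / 2\<close>
  stands for any positive constant.\<close>

lemma lattice_subsequence:
  assumes "\<And>k. unimodular_lattice (M k)" and "\<And>k. systole (M k) \<ge> 1 / 2"
  obtains r :: "nat \<Rightarrow> nat" and N where "strict_mono r" "unimodular_lattice N"
    "\<And>t. (\<lambda>k. systole (flow_lattice t (M (r k)))) \<longlonglongrightarrow> systole (flow_lattice t N)"
proof -
  have "\<exists>A B. M k = lattice_of A B \<and> \<bar>wedge A B\<bar> = 1 \<and> norm A \<le> 4 \<and> norm B \<le> 4" for k
  proof -
    obtain A B where M: "M k = lattice_of A B" and AB: "\<bar>wedge A B\<bar> = 1" "norm A \<le> norm B"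
      "2 * \<bar>A \<bullet> B\<bar> \<le> (norm A)\<^sup>2" using reduced_basis[OF assms(1)] .
    have "A \<noteq> 0" using AB(1) by (auto simp: wedge_def)
    then have "norm A \<ge> 1 / 2"
      using systole_le[OF assms(1), of A k] assms(2)[of k] by (simp add: M lattice_generators)
    then have "1 / 2 * norm B \<le> norm A * norm B" by (rule mult_right_mono) simp
    then have "norm A \<le> 4" "norm B \<le> 4" using reduced_basis_bounds[OF AB] by linarith+
    with M AB(1) show ?thesis by blast
  qed
  then have "\<forall>k. \<exists>A B. M k = lattice_of A B \<and> \<bar>wedge A B\<bar> = 1 \<and> norm A \<le> 4 \<and> norm B \<le> 4" by blast
  then obtain A B where M: "\<And>k. M k = lattice_of (A k) (B k)" and AB: "\<And>k. \<bar>wedge (A k) (B k)\<bar> = 1"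
    and le: "\<And>k. norm (A k) \<le> 4" "\<And>k. norm (B k) \<le> 4" unfolding choice_iff by blast
  have in_cball: "\<forall>k. (A k, B k) \<in> cball 0 4 \<times> cball 0 4" using le by simp
  have "seq_compact (cball (0 :: real^2) 4 \<times> cball (0 :: real^2) 4)"
    by (intro compact_imp_seq_compact compact_Times compact_cball)
  from seq_compactE[OF this in_cball] obtain p r
    where r: "strict_mono (r :: nat \<Rightarrow> nat)" and p: "((\<lambda>k. (A k, B k)) \<circ> r) \<longlonglongrightarrow> p"
    by blast
  define C D where "C = fst p" and "D = snd p"
  have C: "(\<lambda>k. A (r k)) \<longlonglongrightarrow> C" and D: "(\<lambda>k. B (r k)) \<longlonglongrightarrow> D"
    using tendsto_fst[OF p] tendsto_snd[OF p] by (simp_all add: C_def D_def o_def)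
  have "(\<lambda>k. \<bar>wedge (A (r k)) (B (r k))\<bar>) \<longlonglongrightarrow> \<bar>wedge C D\<bar>"
    unfolding wedge_def using C D by (intro tendsto_rabs tendsto_diff tendsto_mult tendsto_vec_nth)
  then have CD: "\<bar>wedge C D\<bar> = 1" using AB by (simp add: LIMSEQ_const_iff)
  show ?thesis
  proof (rule that[OF r])
    show "unimodular_lattice (lattice_of C D)" using CD by (rule unimodular_latticeI)
    fix t
    have "(\<lambda>k. diag_flow t *v A (r k)) \<longlonglongrightarrow> diag_flow t *v C" "(\<lambda>k. diag_flow t *v B (r k)) \<longlonglongrightarrow> diag_flow t *v D"
      by (rule bounded_linear.tendsto[OF matrix_vector_mul_bounded_linear], rule C D)+
    then show "(\<lambda>k. systole (flow_lattice t (M (r k)))) \<longlonglongrightarrow> systole (flow_lattice t (lattice_of C D))"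
      unfolding M flow_lattice_of using AB CD by (intro tendsto_systole) simp_all
  qed
qed

text \<open>Sliding each lattice of a sequence along its orbit, its Mordell constant can be assumed to be
  nearly attained at time 0. Mordell constants are at least 1, so the systoles are then bounded below, and
  a subsequence of the lattices converges. By continuity of the systole the limiting lattice
  realizes the limiting Mordell constant at time 0, and exceeds it at no time.\<close>

theorem closed_mordell_gruber_spectrum: "closed mordell_gruber_spectrum"
  unfolding closed_sequential_limits
proof (intro allI impI, elim conjE)
  fix x :: "nat \<Rightarrow> real" and c
  assume x: "\<forall>k. x k \<in> mordell_gruber_spectrum" and lim: "x \<longlonglongrightarrow> c"
  obtain K where K: "\<And>k. unimodular_lattice (K k)" "\<And>k. x k = mordell_constant (K k)"
    using x unfolding mordell_gruber_spectrum_def image_iff by (metis (no_types) mem_Collect_eq)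
  have "\<exists>t. systole (flow_lattice t (K k)) \<ge> x k - 1 / (real k + 2)" for k
  proof (rule ccontr)
    assume "\<not> ?thesis"
    then have "mordell_constant (K k) \<le> x k - 1 / (real k + 2)"
      by (intro mordell_le K) (auto simp: not_le less_imp_le)
    then show False using K(2)[of k] by (simp add: field_simps)
  qed
  then have "\<forall>k. \<exists>t. systole (flow_lattice t (K k)) \<ge> x k - 1 / (real k + 2)" by blast
  then obtain s where s: "\<And>k. systole (flow_lattice (s k) (K k)) \<ge> x k - 1 / (real k + 2)"
    unfolding choice_iff by blast
  define M where "M k = flow_lattice (s k) (K k)" for k
  have M: "unimodular_lattice (M k)" "mordell_constant (M k) = x k" for k
    using K by (simp_all add: M_def unimodular_flow mordell_flow)
  have "systole (M k) \<ge> 1 / 2" for k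
  proof -
    have "1 / (real k + 2) \<le> 1 / 2" by (simp add: field_simps)
    moreover have "x k \<ge> 1" using mordell_ge_1[OF M(1)] M(2) by metis
    ultimately show ?thesis using s[of k] unfolding M_def by linarith
  qed
  then obtain r N where r: "strict_mono (r :: nat \<Rightarrow> nat)" and N: "unimodular_lattice N"
    and conv: "\<And>t. (\<lambda>k. systole (flow_lattice t (M (r k)))) \<longlonglongrightarrow> systole (flow_lattice t N)"
    using lattice_subsequence[of M] M(1) by blast
  have lim': "(\<lambda>k. x (r k)) \<longlonglongrightarrow> c" using LIMSEQ_subseq_LIMSEQ[OF lim r] by (simp add: o_def)
  have "systole (flow_lattice t N) \<le> c" for t
    by (rule LIMSEQ_le[OF conv lim']) (use systole_le_mordell[OF M(1)] M(2) in auto)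
  then have "mordell_constant N \<le> c" by (rule mordell_le[OF N])
  moreover
  have "(\<lambda>k. 1 / (real (r k) + 2)) \<longlonglongrightarrow> 0"
  proof -
    have "(\<lambda>k. 1 / (real k + 2)) \<longlonglongrightarrow> 0"
      using LIMSEQ_ignore_initial_segment[OF lim_1_over_n, of 2] by (simp add: add.commute)
    from LIMSEQ_subseq_LIMSEQ[OF this r] show ?thesis by (simp add: o_def)
  qed
  then have "(\<lambda>k. x (r k) - 1 / (real (r k) + 2)) \<longlonglongrightarrow> c" using tendsto_diff[OF lim'] by fastforce
  then have "c \<le> systole (flow_lattice 0 N)"
    by (rule LIMSEQ_le[OF _ conv]) (use s in \<open>auto simp: flow_0 M_def\<close>)
  then have "c \<le> mordell_constant N" using systole_le_mordell[OF N] order_trans by blast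
  ultimately show "c \<in> mordell_gruber_spectrum"
    using N unfolding mordell_gruber_spectrum_def by (auto simp: image_iff intro!: exI[of _ N])
qed

section \<open>The lattices of the parametrized family\<close>

definition param_A :: "real \<Rightarrow> real \<Rightarrow> real^2" where
  "param_A \<alpha> \<beta> = (1 / sqrt (1 + \<alpha> * \<beta>)) *\<^sub>R vector [- \<alpha>, 1]"

definition param_B :: "real \<Rightarrow> real \<Rightarrow> real^2" where
  "param_B \<alpha> \<beta> = (1 / sqrt (1 + \<alpha> * \<beta>)) *\<^sub>R vector [1, \<beta>]"

lemma param_lattice_eq: "param_lattice \<alpha> \<beta> = lattice_of (param_A \<alpha> \<beta>) (param_B \<alpha> \<beta>)"
  by (simp add: param_lattice_def param_A_def param_B_def)

lemma param_nth [simp]: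
  "param_A \<alpha> \<beta> $ 1 = - \<alpha> / sqrt (1 + \<alpha> * \<beta>)" "param_A \<alpha> \<beta> $ 2 = 1 / sqrt (1 + \<alpha> * \<beta>)"
  "param_B \<alpha> \<beta> $ 1 = 1 / sqrt (1 + \<alpha> * \<beta>)" "param_B \<alpha> \<beta> $ 2 = \<beta> / sqrt (1 + \<alpha> * \<beta>)"
  by (simp_all add: param_A_def param_B_def)

lemma wedge_param: "0 \<le> \<alpha> \<Longrightarrow> 0 \<le> \<beta> \<Longrightarrow> \<bar>wedge (param_A \<alpha> \<beta>) (param_B \<alpha> \<beta>)\<bar> = 1"
proof -
  assume "0 \<le> \<alpha>" "0 \<le> \<beta>"
  then have pos: "1 + \<alpha> * \<beta> > 0" by (simp add: add_pos_nonneg)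
  then have "sqrt (1 + \<alpha> * \<beta>) * sqrt (1 + \<alpha> * \<beta>) = 1 + \<alpha> * \<beta>" by simp
  then have "wedge (param_A \<alpha> \<beta>) (param_B \<alpha> \<beta>) = - (1 + \<alpha> * \<beta>) / (1 + \<alpha> * \<beta>)"
    by (simp add: wedge_def diff_divide_distrib add_divide_distrib)
  then show ?thesis using pos by simp
qed

lemma unimodular_param: "0 \<le> \<alpha> \<Longrightarrow> 0 \<le> \<beta> \<Longrightarrow> unimodular_lattice (param_lattice \<alpha> \<beta>)"
  unfolding param_lattice_eq by (intro unimodular_latticeI wedge_param)

lemma log_systole_le_local_sup:
  "0 \<le> \<alpha> \<Longrightarrow> 0 \<le> \<beta> \<Longrightarrow> \<bar>u\<bar> \<le> ln 2 \<Longrightarrow> log_systole u (param_lattice \<alpha> \<beta>) \<le> local_sup \<alpha> \<beta>"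
  unfolding local_sup_def by (rule cSUP_upper[OF _ bdd_above_log_systole[OF unimodular_param]]) auto

lemma local_sup_le:
  "(\<And>u. \<bar>u\<bar> \<le> ln 2 \<Longrightarrow> log_systole u (param_lattice \<alpha> \<beta>) \<le> c) \<Longrightarrow> local_sup \<alpha> \<beta> \<le> c"
  unfolding local_sup_def by (rule cSUP_least) auto

lemma local_sup_le_ln_mordell:
  "0 \<le> \<alpha> \<Longrightarrow> 0 \<le> \<beta> \<Longrightarrow> local_sup \<alpha> \<beta> \<le> ln (mordell_constant (param_lattice \<alpha> \<beta>))"
  by (intro local_sup_le log_systole_le_ln_mordell unimodular_param)

subsection \<open>Uniform continuity of the local supremum\<close>

lemma norm_param_le_2:
  assumes "\<alpha> \<in> {0..1}" "\<beta> \<in> {0..1}"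
  shows "norm (param_A \<alpha> \<beta>) \<le> 2" "norm (param_B \<alpha> \<beta>) \<le> 2"
proof -
  have c: "1 + \<alpha> * \<beta> \<ge> 1" using assms by simp
  have sq: "\<alpha>\<^sup>2 \<le> 1" "\<beta>\<^sup>2 \<le> 1" using assms by (simp_all add: power_le_one)
  have "(norm (param_A \<alpha> \<beta>))\<^sup>2 = (\<alpha>\<^sup>2 + 1) / (1 + \<alpha> * \<beta>)" "(norm (param_B \<alpha> \<beta>))\<^sup>2 = (1 + \<beta>\<^sup>2) / (1 + \<alpha> * \<beta>)"
    using c by (simp_all add: norm_real2_squared power_divide add_divide_distrib)
  moreover have "(\<alpha>\<^sup>2 + 1) / (1 + \<alpha> * \<beta>) \<le> 2\<^sup>2" "(1 + \<beta>\<^sup>2) / (1 + \<alpha> * \<beta>) \<le> 2\<^sup>2"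
    using c sq by (simp_all add: divide_le_eq)
  ultimately show "norm (param_A \<alpha> \<beta>) \<le> 2" "norm (param_B \<alpha> \<beta>) \<le> 2"
    by (metis power2_le_imp_le zero_le_numeral)+
qed

text \<open>For flow times in \<open>[- ln 2, ln 2]\<close> lengths change by a factor of at most 2, so a single
  Lipschitz estimate for the systole serves the whole window.\<close>

lemma local_sup_change:
  assumes "\<alpha> \<in> {0..1}" "\<beta> \<in> {0..1}" "\<alpha>' \<in> {0..1}" "\<beta>' \<in> {0..1}"
  shows "local_sup \<alpha>' \<beta>' \<le> local_sup \<alpha> \<beta> +
    8 * (norm (param_A \<alpha>' \<beta>' - param_A \<alpha> \<beta>) + norm (param_B \<alpha>' \<beta>' - param_B \<alpha> \<beta>))"
proof (rule local_sup_le)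
  fix u :: real assume u: "\<bar>u\<bar> \<le> ln 2"
  let ?A = "param_A \<alpha> \<beta>" and ?B = "param_B \<alpha> \<beta>" and ?A' = "param_A \<alpha>' \<beta>'" and ?B' = "param_B \<alpha>' \<beta>'"
  have "exp \<bar>u\<bar> \<le> 2" using u by (metis exp_le_cancel_iff exp_ln zero_less_numeral)
  then have flow: "norm (diag_flow u *v v) \<le> 2 * norm v" for v
    using norm_flow_le[of u v] mult_right_mono[of "exp \<bar>u\<bar>" 2 "norm v"] by simp
  have "norm (diag_flow u *v ?A) \<le> 4" "norm (diag_flow u *v ?B) \<le> 4"
    using flow[of ?A] flow[of ?B] norm_param_le_2[OF assms(1,2)] by linarith+
  then have "log_systole u (param_lattice \<alpha>' \<beta>') \<le> log_systole u (param_lattice \<alpha> \<beta>) +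
      4 * (norm (diag_flow u *v ?A' - diag_flow u *v ?A) + norm (diag_flow u *v ?B' - diag_flow u *v ?B))"
    unfolding log_systole_eq param_lattice_eq flow_lattice_of
    using assms by (intro ln_systole_change_of_basis) (simp_all add: wedge_param)
  also have "\<dots> \<le> local_sup \<alpha> \<beta> + 4 * (2 * norm (?A' - ?A) + 2 * norm (?B' - ?B))"
    using flow[of "?A' - ?A"] flow[of "?B' - ?B"] log_systole_le_local_sup[OF _ _ u, of \<alpha> \<beta>] assms
    unfolding matrix_vector_mult_diff_distrib by (intro add_mono mult_left_mono) auto
  finally show "log_systole u (param_lattice \<alpha>' \<beta>') \<le>
    local_sup \<alpha> \<beta> + 8 * (norm (?A' - ?A) + norm (?B' - ?B))" by simp
qed

lemma continuous_on_param:
  "continuous_on ({0..1} \<times> {0..1}) (\<lambda>p. param_A (fst p) (snd p))"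
  "continuous_on ({0..1} \<times> {0..1}) (\<lambda>p. param_B (fst p) (snd p))"
proof -
  have vec: "vector [x, y] = x *\<^sub>R axis 1 1 + y *\<^sub>R (axis 2 1 :: real^2)" for x y
    by (rule vec2_eqI) (simp_all add: axis_def)
  have "sqrt (1 + fst p * snd p) \<noteq> 0" if "p \<in> {0..1} \<times> {0..1::real}" for p
  proof -
    have "fst p * snd p \<ge> 0" using that by auto
    then show ?thesis by simp
  qed
  then show "continuous_on ({0..1} \<times> {0..1}) (\<lambda>p. param_A (fst p) (snd p))"
    "continuous_on ({0..1} \<times> {0..1}) (\<lambda>p. param_B (fst p) (snd p))"
    unfolding param_A_def param_B_def vec by (auto intro!: continuous_intros)
qed

theorem uniformly_continuous_local_sup:
  "uniformly_continuous_on ({0..1} \<times> {0..1}) (\<lambda>(\<alpha>, \<beta>). local_sup \<alpha> \<beta>)"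
  unfolding uniformly_continuous_on_def
proof (intro allI impI)
  fix e :: real assume e: "e > 0"
  let ?K = "{0..1 :: real} \<times> {0..1 :: real}"
  have K: "compact ?K" by (intro compact_Times compact_Icc)
  have e32: "e / 32 > 0" using e by simp
  obtain d1 where d1: "d1 > 0" and A: "\<And>p q. p \<in> ?K \<Longrightarrow> q \<in> ?K \<Longrightarrow> dist q p < d1 \<Longrightarrow>
      dist (param_A (fst q) (snd q)) (param_A (fst p) (snd p)) < e / 32"
    using compact_uniformly_continuous[OF continuous_on_param(1) K] e32
    by (rule uniformly_continuous_onE) blast
  obtain d2 where d2: "d2 > 0" and B: "\<And>p q. p \<in> ?K \<Longrightarrow> q \<in> ?K \<Longrightarrow> dist q p < d2 \<Longrightarrow>
      dist (param_B (fst q) (snd q)) (param_B (fst p) (snd p)) < e / 32"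
    using compact_uniformly_continuous[OF continuous_on_param(2) K] e32
    by (rule uniformly_continuous_onE) blast
  have *: "local_sup (fst q) (snd q) < local_sup (fst p) (snd p) + e"
    if "p \<in> ?K" "q \<in> ?K" "dist q p < min d1 d2" for p q
  proof -
    have "local_sup (fst q) (snd q) \<le> local_sup (fst p) (snd p) +
      8 * (norm (param_A (fst q) (snd q) - param_A (fst p) (snd p)) +
           norm (param_B (fst q) (snd q) - param_B (fst p) (snd p)))"
      using that by (intro local_sup_change) auto
    then show ?thesis using A[of p q] B[of p q] that e unfolding dist_norm by simp
  qed
  show "\<exists>d>0. \<forall>p\<in>?K. \<forall>q\<in>?K. dist q p < d \<longrightarrow>
      dist (case q of (\<alpha>, \<beta>) \<Rightarrow> local_sup \<alpha> \<beta>) (case p of (\<alpha>, \<beta>) \<Rightarrow> local_sup \<alpha> \<beta>) < e"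
  proof (intro exI[of _ "min d1 d2"] conjI ballI impI)
    show "min d1 d2 > 0" using d1 d2 by simp
    fix p q assume "p \<in> ?K" "q \<in> ?K" "dist q p < min d1 d2"
    then show "dist (case q of (\<alpha>, \<beta>) \<Rightarrow> local_sup \<alpha> \<beta>) (case p of (\<alpha>, \<beta>) \<Rightarrow> local_sup \<alpha> \<beta>) < e"
      using *[of p q] *[of q p] by (simp add: case_prod_beta dist_real_def dist_commute abs_less_iff)
  qed
qed

subsection \<open>Symmetries\<close>

definition mirror :: "real^2 \<Rightarrow> real^2" where
  "mirror v = vector [- v $ 1, v $ 2]"

definition quarter_turn :: "real^2 \<Rightarrow> real^2" where
  "quarter_turn v = vector [v $ 2, - v $ 1]"

lemma symmetry_nth [simp]:
  "mirror v $ 1 = - v $ 1" "mirror v $ 2 = v $ 2"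
  "quarter_turn v $ 1 = v $ 2" "quarter_turn v $ 2 = - v $ 1"
  by (simp_all add: mirror_def quarter_turn_def)

lemma linear_symmetry: "linear mirror" "linear quarter_turn"
  by (rule linearI; rule vec2_eqI; simp)+

lemma norm_symmetry: "norm (mirror v) = norm v" "norm (quarter_turn v) = norm v"
proof -
  have "(norm (mirror v))\<^sup>2 = (norm v)\<^sup>2" "(norm (quarter_turn v))\<^sup>2 = (norm v)\<^sup>2"
    unfolding norm_real2_squared by simp_all
  then show "norm (mirror v) = norm v" "norm (quarter_turn v) = norm v" by simp_all
qed

lemma systole_image_isometry:
  assumes "\<And>v. norm (\<phi> v) = norm v"
  shows "systole (\<phi> ` L) = systole L"
proof -
  have "\<phi> v = 0 \<longleftrightarrow> v = 0" for v using assms[of v] by (metis norm_eq_zero)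
  then have "\<phi> ` L - {0} = \<phi> ` (L - {0})" by auto
  then have "norm ` (\<phi> ` L - {0}) = norm ` (L - {0})" by (simp add: image_image assms)
  then show ?thesis unfolding systole_def by simp
qed

lemma flow_mirror: "flow_lattice t (mirror ` L) = mirror ` flow_lattice t L"
proof -
  have "diag_flow t *v mirror v = mirror (diag_flow t *v v)" for v by (rule vec2_eqI) simp_all
  then show ?thesis by (simp add: image_image)
qed

lemma flow_quarter_turn: "flow_lattice t (quarter_turn ` L) = quarter_turn ` flow_lattice (- t) L"
proof -
  have "diag_flow t *v quarter_turn v = quarter_turn (diag_flow (- t) *v v)" for v by (rule vec2_eqI) simp_all
  then show ?thesis by (simp add: image_image)
qed

lemma log_systole_mirror: "log_systole t (mirror ` L) = log_systole t L"
  by (simp add: log_systole_eq flow_mirror systole_image_isometry norm_symmetry)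

lemma systole_flow_quarter_turn:
  "systole (flow_lattice t (quarter_turn ` L)) = systole (flow_lattice (- t) L)"
  by (simp add: flow_quarter_turn systole_image_isometry norm_symmetry)

text \<open>Exchanging the two coordinates, with a sign to make it a rotation, exchanges the roles of \<open>\<alpha>\<close> and
  \<open>\<beta>\<close> and reverses time.\<close>

lemma quarter_turn_param: "quarter_turn ` param_lattice \<alpha> \<beta> = param_lattice \<beta> \<alpha>"
proof -
  have "quarter_turn (param_B \<alpha> \<beta>) = - param_A \<beta> \<alpha>" "quarter_turn (param_A \<alpha> \<beta>) = param_B \<beta> \<alpha>"
    by (rule vec2_eqI; simp add: mult.commute)+
  then show ?thesis
    unfolding param_lattice_eq linear_image_lattice_of[OF linear_symmetry(2)]
    by (simp add: lattice_of_minus lattice_of_commute[of "param_B \<beta> \<alpha>"])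
qed

lemma log_systole_param_swap: "log_systole t (param_lattice \<beta> \<alpha>) = log_systole (- t) (param_lattice \<alpha> \<beta>)"
  unfolding log_systole_eq quarter_turn_param[of \<alpha> \<beta>, symmetric] systole_flow_quarter_turn ..

lemma local_sup_swap: "local_sup \<beta> \<alpha> = local_sup \<alpha> \<beta>"
proof -
  have "(\<lambda>u. log_systole u (param_lattice \<beta> \<alpha>)) ` {- ln 2..ln 2} =
      (\<lambda>u. log_systole u (param_lattice \<alpha> \<beta>)) ` uminus ` {- ln 2..ln 2}"
    unfolding image_image by (intro image_cong refl log_systole_param_swap)
  then show ?thesis unfolding local_sup_def by simp
qed

lemma mordell_param_swap:
  assumes "0 \<le> \<alpha>" "0 \<le> \<beta>"
  shows "mordell_constant (param_lattice \<beta> \<alpha>) = mordell_constant (param_lattice \<alpha> \<beta>)"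
proof (rule mordell_reparametrize[where h = uminus])
  show "systole (flow_lattice t (param_lattice \<beta> \<alpha>)) = systole (flow_lattice (- t) (param_lattice \<alpha> \<beta>))" for t
    unfolding quarter_turn_param[of \<alpha> \<beta>, symmetric] by (rule systole_flow_quarter_turn)
qed (use assms in \<open>simp_all add: unimodular_param\<close>)

subsection \<open>One step of the continued fraction algorithm\<close>

text \<open>With \<open>\<alpha> = 1 / (k + \<alpha>')\<close>, replacing the basis vector \<open>B\<close> by \<open>B + k A\<close> is one step of the Euclidean
  algorithm on first coordinates. The new basis has, up to a mirror image and the rescaling done by the
  flow, the same shape as the old one, with \<open>\<beta>\<close> replaced by \<open>1 / (k + \<beta>)\<close>.\<close>

lemma param_lattice_step:
  assumes "k > 0" "0 \<le> \<alpha>'" "0 \<le> \<beta>"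
  shows "flow_lattice (ln ((real k + \<alpha>') * (real k + \<beta>)) / 2) (param_lattice (1 / (real k + \<alpha>')) \<beta>) =
    mirror ` param_lattice \<alpha>' (1 / (real k + \<beta>))"
proof -
  define p q \<tau> where "p = real k + \<alpha>'" and "q = real k + \<beta>" and "\<tau> = ln (p * q) / 2"
  define x y z where "x = sqrt p" and "y = sqrt q" and "z = sqrt (p + \<beta>)"
  have pos: "p > 0" "q > 0" "p + \<beta> > 0" using assms by (simp_all add: p_def q_def)
  then have xyz: "x > 0" "y > 0" "z > 0" "x * x = p" "y * y = q" "z * z = p + \<beta>"
    by (simp_all add: x_def y_def z_def)
  have "sqrt (1 + 1 / p * \<beta>) = sqrt ((p + \<beta>) / p)" using pos by (simp add: field_simps)
  then have c: "sqrt (1 + 1 / p * \<beta>) = z / x" by (simp add: x_def z_def real_sqrt_divide)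
  have "p + \<beta> = q + \<alpha>'" by (simp add: p_def q_def)
  then have "sqrt (1 + \<alpha>' * (1 / q)) = sqrt ((p + \<beta>) / q)" using pos by (simp add: field_simps)
  then have c': "sqrt (1 + \<alpha>' * (1 / q)) = z / y" by (simp add: y_def z_def real_sqrt_divide)
  have e: "exp \<tau> = x * y"
  proof -
    have "exp \<tau> * exp \<tau> = p * q" using pos by (simp add: \<tau>_def exp_add[symmetric])
    also have "\<dots> = (x * y) * (x * y)" using xyz(4,5) by (metis mult.assoc mult.left_commute)
    finally have "(exp \<tau>)\<^sup>2 = (x * y)\<^sup>2" by (simp add: power2_eq_square)
    then show ?thesis by (rule power2_eq_imp_eq) (use xyz in auto)
  qed
  have e': "exp (- \<tau>) = 1 / (x * y)" by (simp add: exp_minus e inverse_eq_divide)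
  have k: "real k = x * x - \<alpha>'" "\<beta> + real k = y * y" using xyz by (simp_all add: p_def q_def)
  let ?A = "param_A (1 / p) \<beta>" and ?B = "param_B (1 / p) \<beta>"
  have A: "diag_flow \<tau> *v ?A = mirror (param_B \<alpha>' (1 / q))"
    using xyz(1-3) by (intro vec2_eqI)
      (simp_all only: diag_flow_nth symmetry_nth param_nth c c' e e',
        simp_all add: field_simps flip: xyz(4,5))
  have B: "diag_flow \<tau> *v (?B + of_int (int k) *\<^sub>R ?A) = mirror (param_A \<alpha>' (1 / q))"
  proof (rule vec2_eqI)
    have "(?B + of_int (int k) *\<^sub>R ?A) $ 1 = (1 - real k / p) * (x / z)"
      using pos(1) xyz(3) by (simp only: vector_add_component vector_scaleR_component param_nth c)
        (simp add: field_simps)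
    also have "1 - real k / p = \<alpha>' / (x * x)" using xyz(1) by (simp add: k(1) xyz(4)[symmetric] field_simps)
    finally show "(diag_flow \<tau> *v (?B + of_int (int k) *\<^sub>R ?A)) $ 1 = mirror (param_A \<alpha>' (1 / q)) $ 1"
      using xyz(1-3) by (simp only: diag_flow_nth symmetry_nth param_nth c' e) (simp add: field_simps)
    have "(?B + of_int (int k) *\<^sub>R ?A) $ 2 = (\<beta> + real k) * (x / z)"
      using pos(1) xyz(3) by (simp only: vector_add_component vector_scaleR_component param_nth c)
        (simp add: field_simps)
    then show "(diag_flow \<tau> *v (?B + of_int (int k) *\<^sub>R ?A)) $ 2 = mirror (param_A \<alpha>' (1 / q)) $ 2"
      using xyz(1-3) by (simp only: diag_flow_nth symmetry_nth param_nth c' e' k(2)) (simp add: field_simps)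
  qed
  have "flow_lattice \<tau> (param_lattice (1 / p) \<beta>) = flow_lattice \<tau> (lattice_of ?A (?B + of_int (int k) *\<^sub>R ?A))"
    by (simp only: param_lattice_eq lattice_of_shear)
  also have "\<dots> = mirror ` param_lattice \<alpha>' (1 / q)"
    by (simp only: flow_lattice_of A B param_lattice_eq linear_image_lattice_of[OF linear_symmetry(1)])
      (rule lattice_of_commute)
  finally show ?thesis unfolding \<tau>_def p_def q_def .
qed

lemma log_systole_step:
  assumes "k > 0" "0 \<le> \<alpha>'" "0 \<le> \<beta>"
  shows "log_systole t (param_lattice \<alpha>' (1 / (real k + \<beta>))) =
    log_systole (t + ln ((real k + \<alpha>') * (real k + \<beta>)) / 2) (param_lattice (1 / (real k + \<alpha>')) \<beta>)"
  unfolding log_systole_flow[symmetric] param_lattice_step[OF assms] log_systole_mirror ..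

lemma mordell_step:
  assumes "k > 0" "0 \<le> \<alpha>'" "0 \<le> \<beta>"
  shows "mordell_constant (param_lattice \<alpha>' (1 / (real k + \<beta>))) = mordell_constant (param_lattice (1 / (real k + \<alpha>')) \<beta>)"
proof -
  let ?L = "param_lattice (1 / (real k + \<alpha>')) \<beta>" and ?L' = "param_lattice \<alpha>' (1 / (real k + \<beta>))"
  let ?\<tau> = "ln ((real k + \<alpha>') * (real k + \<beta>)) / 2"
  have uni: "unimodular_lattice ?L" "unimodular_lattice ?L'" using assms by (simp_all add: unimodular_param)
  have "mordell_constant ?L' = mordell_constant (flow_lattice ?\<tau> ?L)"
  proof (rule mordell_reparametrize[where h = "\<lambda>t. t"])
    show "systole (flow_lattice t ?L') = systole (flow_lattice t (flow_lattice ?\<tau> ?L))" for t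
      unfolding param_lattice_step[OF assms] flow_mirror by (simp add: systole_image_isometry norm_symmetry)
  qed (simp_all add: uni unimodular_flow)
  then show ?thesis by (simp add: mordell_flow uni)
qed

text \<open>The image of the basis vector \<open>A\<close> under the flow has squared length at most \<open>1 / 2 + 1 / 4\<close>.\<close>

lemma log_systole_neg:
  assumes "0 \<le> \<alpha>" "0 \<le> \<beta>" "(exp t)\<^sup>2 * \<alpha>\<^sup>2 \<le> 1 / 2" "(exp (- t))\<^sup>2 \<le> 1 / 4"
  shows "log_systole t (param_lattice \<alpha> \<beta>) < 0"
proof -
  let ?A = "param_A \<alpha> \<beta>"
  have c: "1 + \<alpha> * \<beta> \<ge> 1" using assms by simp
  have "(norm (diag_flow t *v ?A))\<^sup>2 = ((exp t)\<^sup>2 * \<alpha>\<^sup>2 + (exp (- t))\<^sup>2) / (1 + \<alpha> * \<beta>)"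
    using c by (simp add: norm_flow_squared power_divide add_divide_distrib)
  also have "\<dots> \<le> (3 / 4) / 1"
    using assms c by (intro frac_le) auto
  finally have "(norm (diag_flow t *v ?A))\<^sup>2 < 1\<^sup>2" by simp
  then have "norm (diag_flow t *v ?A) < 1" by (rule power2_less_imp_less) simp
  moreover have "?A \<noteq> 0" using param_nth(2)[of \<alpha> \<beta>] c by (auto simp: vec_eq_iff forall_2)
  then have "log_systole t (param_lattice \<alpha> \<beta>) \<le> ln (norm (diag_flow t *v ?A))"
    using assms by (intro log_systole_le_ln_norm unimodular_param) (simp_all add: param_lattice_eq lattice_generators)
  moreover have "diag_flow t *v ?A \<noteq> 0"
    using param_nth(2)[of \<alpha> \<beta>] c by (auto simp: vec_eq_iff forall_2)
  ultimately show ?thesis by (metis ln_less_zero_iff order_le_less_trans zero_less_norm_iff)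
qed

section \<open>Values of continued fractions\<close>

lemma cf_seq_cases:
  assumes "cf_seq s"
  obtains (infinity) "s 0 = Some \<infinity>"
    | (finite) k where "k > 0" "s 0 = Some (enat k)" "cf_seq (\<lambda>i. s (Suc i))"
proof (cases "s 0 = Some \<infinity>")
  case True
  then show ?thesis by (rule infinity)
next
  case False
  consider (a) "\<forall>i. \<exists>k>0. s i = Some (enat k)"
    | (b) m where "\<forall>i<m. \<exists>k>0. s i = Some (enat k)" "s m = Some \<infinity>" "\<forall>i>m. s i = None"
    using assms unfolding cf_seq_def by blast
  then show ?thesis
  proof cases
    case a
    then obtain k where "k > 0" "s 0 = Some (enat k)" by blast
    moreover have "cf_seq (\<lambda>i. s (Suc i))" using a unfolding cf_seq_def by blast
    ultimately show ?thesis by (rule finite)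
  next
    case b
    then obtain m' where m: "m = Suc m'" using False by (cases m) auto
    then obtain k where "k > 0" "s 0 = Some (enat k)" using b by blast
    moreover have "cf_seq (\<lambda>i. s (Suc i))"
      unfolding cf_seq_def using b m by (intro disjI2 exI[of _ m']) auto
    ultimately show ?thesis by (rule finite)
  qed
qed

lemma cf_seq_prepend:
  assumes "s 0 = Some (enat k)" "k > 0" "cf_seq (\<lambda>i. s (Suc i))"
  shows "cf_seq s"
proof -
  consider (a) "\<forall>i. \<exists>k>0. s (Suc i) = Some (enat k)"
    | (b) m where "\<forall>i<m. \<exists>k>0. s (Suc i) = Some (enat k)" "s (Suc m) = Some \<infinity>" "\<forall>i>m. s (Suc i) = None"
    using assms(3) unfolding cf_seq_def by blast
  then show ?thesis
  proof cases
    case a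
    have "\<exists>k>0. s i = Some (enat k)" for i using a assms(1,2) by (cases i) auto
    then show ?thesis unfolding cf_seq_def by blast
  next
    case b
    have "\<exists>k>0. s i = Some (enat k)" if "i < Suc m" for i using b(1) that assms(1,2) by (cases i) auto
    moreover have "s i = None" if "i > Suc m" for i using b(3) that by (cases i) auto
    ultimately show ?thesis unfolding cf_seq_def using b(2) by blast
  qed
qed

lemma cf_convergent_in_01: "cf_seq s \<Longrightarrow> cf_convergent m s \<in> {0..1}"
proof (induction m arbitrary: s)
  case 0
  then show ?case by simp
next
  case (Suc m)
  from Suc.prems show ?case
  proof (cases rule: cf_seq_cases)
    case infinity
    then show ?thesis by simp
  next
    case (finite k)
    have "cf_convergent m (\<lambda>i. s (Suc i)) \<in> {0..1}" by (rule Suc.IH[OF finite(3)])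
    then show ?thesis using finite(1,2) by (simp add: divide_le_eq)
  qed
qed

text \<open>The map \<open>z \<mapsto> 1 / (k + 1 / (l + z))\<close> contracts \<open>[0, \<infinity>)\<close> by \<open>1 / 4\<close>, so two convergents that
  share their first \<open>2 j\<close> partial quotients are close.\<close>

lemma two_steps_contract:
  fixes y z :: real
  assumes "k > 0" "l > 0" "0 \<le> y" "0 \<le> z"
  shows "\<bar>1 / (real k + 1 / (real l + y)) - 1 / (real k + 1 / (real l + z))\<bar> \<le> \<bar>y - z\<bar> / 4"
proof -
  let ?d = "\<lambda>z. real k * (real l + z) + 1"
  have l: "real l + y > 0" "real l + z > 0" using assms by simp_all
  have "1 * 1 \<le> real k * (real l + y)" "1 * 1 \<le> real k * (real l + z)"
    using assms by (intro mult_mono; simp)+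
  then have d: "?d y \<ge> 2" "?d z \<ge> 2" by simp_all
  have "1 / (real k + 1 / (real l + y)) = (real l + y) / ?d y" "1 / (real k + 1 / (real l + z)) = (real l + z) / ?d z"
    using l by (simp_all add: field_simps)
  moreover have "(real l + y) / ?d y - (real l + z) / ?d z = (y - z) / (?d y * ?d z)"
    using d by (subst diff_frac_eq) (auto simp: algebra_simps)
  ultimately have "\<bar>1 / (real k + 1 / (real l + y)) - 1 / (real k + 1 / (real l + z))\<bar> = \<bar>y - z\<bar> / (?d y * ?d z)"
    using d by (simp add: abs_divide abs_mult)
  moreover have "2 * 2 \<le> ?d y * ?d z" using d by (intro mult_mono) auto
  then have "\<bar>y - z\<bar> / (?d y * ?d z) \<le> \<bar>y - z\<bar> / 4" by (intro frac_le) auto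
  ultimately show ?thesis by simp
qed

lemma cf_convergent_close:
  assumes "cf_seq s" "m \<ge> 2 * j" "n \<ge> 2 * j"
  shows "\<bar>cf_convergent m s - cf_convergent n s\<bar> \<le> (1 / 4) ^ j"
  using assms
proof (induction j arbitrary: s m n)
  case 0
  then show ?case using cf_convergent_in_01[OF 0(1), of m] cf_convergent_in_01[OF 0(1), of n] by (auto simp: abs_le_iff)
next
  case (Suc j)
  obtain m' n' where mn: "m = Suc (Suc m')" "n = Suc (Suc n')" "m' \<ge> 2 * j" "n' \<ge> 2 * j"
    using Suc.prems(2,3) that[of "m - 2" "n - 2"] by fastforce
  from Suc.prems(1) show ?case
  proof (cases rule: cf_seq_cases)
    case infinity
    then show ?thesis by (simp add: mn)
  next
    case k: (finite k)
    from k(3) show ?thesis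
    proof (cases rule: cf_seq_cases)
      case infinity
      then show ?thesis by (simp add: mn k(2))
    next
      case l: (finite l)
      let ?s = "\<lambda>i. s (Suc (Suc i))"
      have s: "cf_seq ?s" using l(3) by simp
      have "\<bar>cf_convergent m s - cf_convergent n s\<bar> \<le> \<bar>cf_convergent m' ?s - cf_convergent n' ?s\<bar> / 4"
        using two_steps_contract[OF k(1) l(1), of "cf_convergent m' ?s" "cf_convergent n' ?s"]
          cf_convergent_in_01[OF s] l(2) by (simp add: mn k(2))
      also have "\<dots> \<le> (1 / 4) ^ j / 4" using Suc.IH[OF s mn(3,4)] by simp
      finally show ?thesis by simp
    qed
  qed
qed

lemma cf_convergent_tendsto:
  assumes "cf_seq s"
  shows "(\<lambda>m. cf_convergent m s) \<longlonglongrightarrow> cf_value s"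
proof -
  have "Cauchy (\<lambda>m. cf_convergent m s)"
  proof (rule CauchyI)
    fix e :: real assume "e > 0"
    then obtain j where "(1 / 4) ^ j < e" using real_arch_pow_inv[of e "1 / 4"] by auto
    then show "\<exists>M. \<forall>m\<ge>M. \<forall>n\<ge>M. norm (cf_convergent m s - cf_convergent n s) < e"
      using le_less_trans[OF cf_convergent_close[OF assms]] unfolding real_norm_def by blast
  qed
  then show ?thesis unfolding cf_value_def by (simp add: Cauchy_convergent_iff convergent_LIMSEQ_iff)
qed

lemma cf_value_in_01: "cf_seq s \<Longrightarrow> cf_value s \<in> {0..1}"
  using cf_convergent_tendsto cf_convergent_in_01
  by (intro Lim_in_closed_set[of "{0..1}" "\<lambda>m. cf_convergent m s" sequentially]) auto

lemma cf_value_infinity: "s 0 = Some \<infinity> \<Longrightarrow> cf_value s = 0"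
proof -
  assume "s 0 = Some \<infinity>"
  then have "cf_convergent m s = 0" for m by (cases m) simp_all
  then show "cf_value s = 0" unfolding cf_value_def by (simp add: limI)
qed

lemma cf_value_step:
  assumes "s 0 = Some (enat k)" "k > 0" "cf_seq (\<lambda>i. s (Suc i))"
  shows "cf_value s = 1 / (real k + cf_value (\<lambda>i. s (Suc i)))"
proof (rule LIMSEQ_unique)
  show "(\<lambda>m. cf_convergent (Suc m) s) \<longlonglongrightarrow> cf_value s"
    by (rule LIMSEQ_Suc[OF cf_convergent_tendsto[OF cf_seq_prepend[OF assms]]])
  have "real k + cf_value (\<lambda>i. s (Suc i)) \<noteq> 0"
    using cf_value_in_01[OF assms(3)] assms(2) by auto
  then show "(\<lambda>m. cf_convergent (Suc m) s) \<longlonglongrightarrow> 1 / (real k + cf_value (\<lambda>i. s (Suc i)))"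
    by (simp add: assms(1)) (intro tendsto_intros cf_convergent_tendsto[OF assms(3)])
qed

section \<open>The orbit of a lattice along its continued fraction\<close>

definition valid_index :: "(int \<Rightarrow> enat option) \<Rightarrow> int \<Rightarrow> bool" where
  "valid_index a n \<longleftrightarrow> cf_seq (right_seq a (n - 1)) \<and> cf_seq (left_seq a n)"

abbreviation cf_lattice :: "(int \<Rightarrow> enat option) \<Rightarrow> int \<Rightarrow> (real^2) set" where
  "cf_lattice a n \<equiv> param_lattice (alpha_cf a (n - 1)) (beta_cf a n)"

abbreviation cf_local_sup :: "(int \<Rightarrow> enat option) \<Rightarrow> int \<Rightarrow> real" where
  "cf_local_sup a n \<equiv> local_sup (alpha_cf a (n - 1)) (beta_cf a n)"

lemma cf_ranges:
  assumes "valid_index a n"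
  shows "0 \<le> alpha_cf a (n - 1)" "alpha_cf a (n - 1) \<le> 1" "0 \<le> beta_cf a n" "beta_cf a n \<le> 1"
  using assms cf_value_in_01 unfolding valid_index_def alpha_cf_def beta_cf_def by auto

lemma right_seq_shift: "(\<lambda>i. right_seq a (n - 1) (Suc i)) = right_seq a n" "right_seq a (n - 1) 0 = a n"
  by (auto simp: right_seq_def algebra_simps)

lemma left_seq_shift: "(\<lambda>i. left_seq a (n + 1) (Suc i)) = left_seq a n" "left_seq a (n + 1) 0 = a n"
  by (auto simp: left_seq_def algebra_simps)

text \<open>The index \<open>n\<close> can be increased unless \<open>a\<^sub>n = \<infinity>\<close>, and then the parameters change as in one step of the
  continued fraction algorithm.\<close>

lemma valid_index_cases:
  assumes "valid_index a n"
  obtains (last) "a n = Some \<infinity>" "alpha_cf a (n - 1) = 0"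
    | (step) k where "k > 0" "a n = Some (enat k)" "valid_index a (n + 1)"
        "alpha_cf a (n - 1) = 1 / (real k + alpha_cf a n)" "beta_cf a (n + 1) = 1 / (real k + beta_cf a n)"
proof -
  have R: "cf_seq (right_seq a (n - 1))" and L: "cf_seq (left_seq a n)"
    using assms by (simp_all add: valid_index_def)
  from R show ?thesis
  proof (cases rule: cf_seq_cases)
    case infinity
    then show ?thesis by (intro last) (simp_all add: right_seq_shift alpha_cf_def cf_value_infinity)
  next
    case (finite k)
    have left: "left_seq a (n + 1) 0 = Some (enat k)" "cf_seq (\<lambda>i. left_seq a (n + 1) (Suc i))"
      using finite(2) L by (simp_all add: left_seq_shift right_seq_shift)
    show ?thesis
    proof (rule step[OF finite(1)])
      show "a n = Some (enat k)" using finite(2) by (simp add: right_seq_shift)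
      show "valid_index a (n + 1)"
        using finite(3) cf_seq_prepend[OF left(1) finite(1) left(2)] by (simp add: valid_index_def right_seq_shift)
      show "alpha_cf a (n - 1) = 1 / (real k + alpha_cf a n)"
        using cf_value_step[OF finite(2,1,3)] by (simp add: alpha_cf_def right_seq_shift)
      show "beta_cf a (n + 1) = 1 / (real k + beta_cf a n)"
        using cf_value_step[OF left(1) finite(1) left(2)] by (simp add: beta_cf_def left_seq_shift)
    qed
  qed
qed

subsection \<open>The windows around the reduction times see every large systole\<close>

lemma exp_twice_ln_half: "x > 0 \<Longrightarrow> (exp (ln x / 2))\<^sup>2 = (x :: real)"
  by (simp add: power2_eq_square exp_add[symmetric])

lemma exp_minus_squared_le: "ln 2 \<le> t \<Longrightarrow> (exp (- t))\<^sup>2 \<le> (1 / 4 :: real)"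
proof -
  assume "ln 2 \<le> t"
  then have "exp (- t) \<le> exp (- ln 2 :: real)" by simp
  then have "exp (- t) \<le> 1 / 2" by (simp add: exp_minus)
  then have "(exp (- t))\<^sup>2 \<le> (1 / 2)\<^sup>2" by (intro power_mono) auto
  then show ?thesis by (simp add: power2_eq_square)
qed

text \<open>The consecutive reduction times are \<open>0\<close> and \<open>\<tau> = ln (p q) / 2\<close> with \<open>p = k + \<alpha>'\<close> and \<open>q = k + \<beta>\<close>. Up to time
  \<open>\<tau> - ln 2\<close> the first coordinate of \<open>A\<close> grows to at most \<open>sqrt (p q) / (2 p)\<close>, and \<open>q \<le> 2 p\<close>; from time
  \<open>ln 2\<close> on its second coordinate is at most \<open>1 / 2\<close>.\<close>

lemma log_systole_neg_in_gap:
  assumes k: "k > 0" and ab: "0 \<le> \<alpha>'" "0 \<le> \<beta>" "\<beta> \<le> 1"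
    and t: "ln 2 \<le> t" "t \<le> ln ((real k + \<alpha>') * (real k + \<beta>)) / 2 - ln 2"
  shows "log_systole t (param_lattice (1 / (real k + \<alpha>')) \<beta>) < 0"
proof (rule log_systole_neg)
  define p q where "p = real k + \<alpha>'" and "q = real k + \<beta>"
  have pq: "p > 0" "q > 0" "q \<le> 2 * p" using k ab by (simp_all add: p_def q_def)
  have "exp t \<le> exp (ln (p * q) / 2 - ln 2)" using t(2) by (simp add: p_def q_def)
  also have "\<dots> = exp (ln (p * q) / 2) / 2" by (simp add: exp_diff)
  finally have "(exp t)\<^sup>2 \<le> (exp (ln (p * q) / 2) / 2)\<^sup>2" by (intro power_mono) auto
  also have "\<dots> = p * q / 4" using pq by (simp add: power_divide exp_twice_ln_half)
  finally have "(exp t)\<^sup>2 * (1 / p)\<^sup>2 \<le> (p * q / 4) * (1 / p)\<^sup>2" by (rule mult_right_mono) simp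
  also have "\<dots> = q / (4 * p)" using pq by (simp add: field_simps power2_eq_square)
  also have "\<dots> \<le> 1 / 2" using pq by (simp add: field_simps)
  finally show "(exp t)\<^sup>2 * (1 / (real k + \<alpha>'))\<^sup>2 \<le> 1 / 2" by (simp add: p_def)
qed (use ab exp_minus_squared_le[OF t(1)] in auto)

text \<open>Step through the reduction times until \<open>t\<close> lies in a window. This takes finitely many steps, as the
  reduction times of an infinite expansion tend to infinity, and the search cannot end in a gap or
  beyond the last window, because the log-systole is negative there.\<close>

lemma window_ahead:
  assumes "valid_index a n" "0 \<le> t" "0 \<le> log_systole t (cf_lattice a n)"
  shows "\<exists>m. valid_index a m \<and> log_systole t (cf_lattice a n) \<le> cf_local_sup a m"
proof -
  define c :: real where "c = ln (3 / 2) / 2"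
  have c: "c > 0" by (simp add: c_def)
  obtain N where N: "t + c < real N * c"
    using reals_Archimedean3[OF c] by blast
  \<comment> \<open>A single step may take arbitrarily little time, namely when \<open>k = 1\<close> and \<open>\<alpha>'\<close> and \<open>\<beta>\<close> are small; the
    term that depends on \<open>\<beta> < 1 / 2\<close> pays for such a step, since the next \<open>\<beta>\<close> is then at least \<open>1 / 2\<close>.\<close>
  have "t + (if beta_cf a n < 1 / 2 then c else 0) < real N * c" using N c by simp
  with assms show ?thesis
  proof (induction N arbitrary: n t)
    case 0
    then show ?case using c by (auto split: if_splits)
  next
    case (Suc N)
    note R = cf_ranges[OF Suc.prems(1)]
    show ?case
    proof (cases "t \<le> ln 2")
      case True
      then have "log_systole t (cf_lattice a n) \<le> cf_local_sup a n"
        using R Suc.prems(2) by (intro log_systole_le_local_sup) auto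
      then show ?thesis using Suc.prems(1) by blast
    next
      case False
      from Suc.prems(1) show ?thesis
      proof (cases rule: valid_index_cases)
        case last
        have "log_systole t (cf_lattice a n) < 0"
          using R False by (intro log_systole_neg exp_minus_squared_le) (simp_all add: last)
        then show ?thesis using Suc.prems(3) by simp
      next
        case (step k)
        have k: "real k \<ge> 1" using step(1) by simp
        define \<alpha>' \<beta> where "\<alpha>' = alpha_cf a n" and "\<beta> = beta_cf a n"
        define pq where "pq = (real k + \<alpha>') * (real k + \<beta>)"
        define \<tau> where "\<tau> = ln pq / 2"
        have R': "0 \<le> \<alpha>'" "\<alpha>' \<le> 1" "0 \<le> \<beta>" "\<beta> \<le> 1"
          using cf_ranges[OF step(3)] R by (simp_all add: \<alpha>'_def \<beta>_def)
        have move: "log_systole t (cf_lattice a n) = log_systole (t - \<tau>) (cf_lattice a (n + 1))"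
          using log_systole_step[OF step(1) R'(1,3), of "t - \<tau>"]
          by (simp add: step(4,5) \<alpha>'_def \<beta>_def \<tau>_def pq_def)
        show ?thesis
        proof (cases "t \<ge> \<tau>")
          case True
          have pq_ge: "pq \<ge> x * y" if "real k + \<alpha>' \<ge> x" "real k + \<beta> \<ge> y" "x \<ge> 0" "y \<ge> 0" for x y
            unfolding pq_def using that R' k by (intro mult_mono) auto
          have \<tau>_ge: "\<tau> \<ge> ln x / 2" if "pq \<ge> x" "x > 0" for x
            using that by (simp add: \<tau>_def)
          have drop: "\<tau> + (if \<beta> < 1 / 2 then c else 0) - (if beta_cf a (n + 1) < 1 / 2 then c else 0) \<ge> c"
          proof (cases "k = 1")
            case True
            then have "beta_cf a (n + 1) \<ge> 1 / 2"
              unfolding step(5) \<beta>_def[symmetric] using R' by (intro frac_le) auto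
            moreover have "\<tau> \<ge> 0" using \<tau>_ge[of 1] pq_ge[of 1 1] k R' by simp
            moreover have "\<tau> \<ge> c" if "\<beta> \<ge> 1 / 2"
              using \<tau>_ge[of "3 / 2"] pq_ge[of 1 "3 / 2"] k R' that by (simp add: c_def)
            ultimately show ?thesis by auto
          next
            case False
            then have "real k \<ge> 2" using step(1) by simp
            then have "pq \<ge> (3 / 2)\<^sup>2" using pq_ge[of "3 / 2" "3 / 2"] R' by (simp add: power2_eq_square)
            then have "\<tau> \<ge> ln ((3 / 2)\<^sup>2) / 2" by (intro \<tau>_ge) auto
            then have "\<tau> \<ge> 2 * c" by (simp add: c_def ln_realpow)
            then show ?thesis using c by auto
          qed
          have "\<exists>m. valid_index a m \<and> log_systole (t - \<tau>) (cf_lattice a (n + 1)) \<le> cf_local_sup a m"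
          proof (rule Suc.IH[OF step(3)])
            show "0 \<le> t - \<tau>" using True by simp
            show "0 \<le> log_systole (t - \<tau>) (cf_lattice a (n + 1))" using Suc.prems(3) move by simp
            have "real (Suc N) * c = real N * c + c" by (simp add: algebra_simps)
            then show "t - \<tau> + (if beta_cf a (n + 1) < 1 / 2 then c else 0) < real N * c"
              using Suc.prems(4) drop unfolding \<beta>_def[symmetric] by linarith
          qed
          then show ?thesis unfolding move .
        next
          case before: False
          show ?thesis
          proof (cases "\<tau> - t \<le> ln 2")
            case True
            have "log_systole (t - \<tau>) (cf_lattice a (n + 1)) \<le> cf_local_sup a (n + 1)"
              using cf_ranges[OF step(3)] before True by (intro log_systole_le_local_sup) auto
            then show ?thesis using step(3) unfolding move by blast
          next
            case in_gap: False
            have "log_systole t (param_lattice (1 / (real k + \<alpha>')) \<beta>) < 0"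
              using \<open>\<not> t \<le> ln 2\<close> in_gap
              by (intro log_systole_neg_in_gap[OF step(1) R'(1,3,4)]) (simp_all add: \<tau>_def pq_def)
            then show ?thesis using Suc.prems(3) by (simp add: step(4) \<alpha>'_def \<beta>_def)
          qed
        qed
      qed
    qed
  qed
qed

subsection \<open>All the lattices along the continued fraction share one Mordell constant\<close>

lemma mordell_next:
  assumes "valid_index a n" "a n \<noteq> Some \<infinity>"
  shows "mordell_constant (cf_lattice a (n + 1)) = mordell_constant (cf_lattice a n)"
  using assms(1)
proof (cases rule: valid_index_cases)
  case last
  then show ?thesis using assms(2) by simp
next
  case (step k)
  show ?thesis
    using mordell_step[OF step(1), of "alpha_cf a n" "beta_cf a n"] cf_ranges[OF assms(1)] cf_ranges[OF step(3)]
    by (simp add: step(4,5))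
qed

text \<open>Going back from index \<open>n + 1 > 0\<close>, the left sequence starts with \<open>a\<^sub>n\<close> and contains \<open>a\<^sub>-\<^sub>1\<close>. If
  \<open>a\<^sub>n\<close> were \<open>\<infinity>\<close>, all later entries including \<open>a\<^sub>-\<^sub>1\<close> would have to be undefined.\<close>

lemma valid_index_prev:
  assumes "valid_index a 0" "valid_index a (n + 1)" "n \<ge> 0"
  shows "valid_index a n \<and> a n \<noteq> Some \<infinity>"
proof -
  have L: "cf_seq (left_seq a (n + 1))" and R: "cf_seq (right_seq a n)"
    using assms(2) by (simp_all add: valid_index_def)
  have "a n \<noteq> Some \<infinity>"
  proof
    assume inf: "a n = Some \<infinity>"
    have "cf_seq (left_seq a 0)" using assms(1) by (simp add: valid_index_def)
    then have "left_seq a 0 0 \<noteq> None" by (auto elim: cf_seq_cases)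
    then have "left_seq a (n + 1) (nat n + 1) \<noteq> None"
      using assms(3) by (simp add: left_seq_def)
    moreover have "left_seq a (n + 1) 0 = Some \<infinity>" by (simp add: left_seq_shift inf)
    then have "left_seq a (n + 1) i = None" if "i > 0" for i
      using L that unfolding cf_seq_def by (metis enat.distinct(1) not_gr_zero option.inject)
    ultimately show False by simp
  qed
  moreover from L have "valid_index a n"
  proof (cases rule: cf_seq_cases)
    case infinity
    then show ?thesis using \<open>a n \<noteq> Some \<infinity>\<close> by (simp add: left_seq_shift)
  next
    case (finite k)
    have "right_seq a (n - 1) 0 = Some (enat k)" using finite(2) by (simp add: left_seq_shift right_seq_shift)
    then have "cf_seq (right_seq a (n - 1))"
      by (rule cf_seq_prepend[OF _ finite(1)]) (simp add: right_seq_shift R)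
    then show ?thesis using finite(3) by (simp add: valid_index_def left_seq_shift)
  qed
  ultimately show ?thesis by blast
qed

lemma mordell_ahead:
  assumes "valid_index a 0" "valid_index a (int j)"
  shows "mordell_constant (cf_lattice a (int j)) = mordell_constant (cf_lattice a 0)"
  using assms(2)
proof (induction j)
  case 0
  then show ?case by simp
next
  case (Suc j)
  have "valid_index a (int j) \<and> a (int j) \<noteq> Some \<infinity>"
    using valid_index_prev[OF assms(1), of "int j"] Suc.prems by (simp add: add.commute)
  then show ?case using mordell_next[of a "int j"] Suc.IH by (simp add: add.commute)
qed

definition reverse_seq :: "(int \<Rightarrow> enat option) \<Rightarrow> int \<Rightarrow> enat option" where
  "reverse_seq a i = a (- 1 - i)"

lemma right_left_reverse:
  "right_seq (reverse_seq a) (n - 1) = left_seq a (- n)" "left_seq (reverse_seq a) n = right_seq a (- n - 1)"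
  unfolding reverse_seq_def right_seq_def left_seq_def by (intro ext arg_cong[where f = a]; simp)+

lemma reverse_index:
  "valid_index (reverse_seq a) n \<longleftrightarrow> valid_index a (- n)"
  "alpha_cf (reverse_seq a) (n - 1) = beta_cf a (- n)" "beta_cf (reverse_seq a) n = alpha_cf a (- n - 1)"
  by (auto simp: valid_index_def alpha_cf_def beta_cf_def right_left_reverse)

lemma mordell_along_cf:
  assumes "valid_index a 0" "valid_index a n"
  shows "mordell_constant (cf_lattice a n) = mordell_constant (cf_lattice a 0)"
proof (cases "n \<ge> 0")
  case True
  then show ?thesis using mordell_ahead[OF assms(1), of "nat n"] assms(2) by simp
next
  case False
  have "mordell_constant (cf_lattice (reverse_seq a) (int (nat (- n)))) = mordell_constant (cf_lattice (reverse_seq a) 0)"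
    using assms False by (intro mordell_ahead) (simp_all add: reverse_index)
  then have "mordell_constant (param_lattice (beta_cf a n) (alpha_cf a (n - 1))) =
      mordell_constant (param_lattice (beta_cf a 0) (alpha_cf a (- 1)))"
    using False reverse_index(2,3)[of a 0] reverse_index(2,3)[of a "- n"] by simp
  then show ?thesis
    using cf_ranges[OF assms(1)] cf_ranges[OF assms(2)] by (simp add: mordell_param_swap)
qed

lemma window_anywhere:
  assumes "valid_index a 0" "0 \<le> log_systole t (cf_lattice a 0)"
  shows "\<exists>m. valid_index a m \<and> log_systole t (cf_lattice a 0) \<le> cf_local_sup a m"
proof (cases "t \<ge> 0")
  case True
  then show ?thesis by (rule window_ahead[OF assms(1) _ assms(2)])
next
  case False
  have lattice: "log_systole (- t) (cf_lattice (reverse_seq a) 0) = log_systole t (cf_lattice a 0)"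
    using reverse_index(2,3)[of a 0] log_systole_param_swap[of "- t" "beta_cf a 0" "alpha_cf a (- 1)"] by simp
  obtain m where m: "valid_index (reverse_seq a) m"
    "log_systole (- t) (cf_lattice (reverse_seq a) 0) \<le> cf_local_sup (reverse_seq a) m"
    using window_ahead[of "reverse_seq a" 0 "- t"] assms False unfolding lattice by (auto simp: reverse_index)
  have "cf_local_sup (reverse_seq a) m = cf_local_sup a (- m)"
    unfolding reverse_index(2,3) by (rule local_sup_swap)
  then show ?thesis using m unfolding lattice reverse_index(1) by (intro exI[of _ "- m"]) simp
qed

text \<open>The log-systole is bounded by the supremum over the windows first at times where it is nonnegative.
  Since such times exist, that supremum is itself nonnegative, and so it also bounds the negative
  values.\<close>

theorem ln_mordell_eq_SUP_local_sup:
  assumes "valid_index a 0"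
  shows "ln (mordell_constant (cf_lattice a 0)) = (SUP n\<in>{n. valid_index a n}. cf_local_sup a n)"
proof -
  let ?L = "cf_lattice a 0" and ?S = "SUP n\<in>{n. valid_index a n}. cf_local_sup a n"
  have L: "unimodular_lattice ?L" using cf_ranges[OF assms] by (intro unimodular_param)
  have upper: "cf_local_sup a n \<le> ln (mordell_constant ?L)" if "valid_index a n" for n
    using local_sup_le_ln_mordell cf_ranges[OF that] mordell_along_cf[OF assms that] by metis
  then have bdd: "bdd_above ((\<lambda>n. cf_local_sup a n) ` {n. valid_index a n})" by (intro bdd_aboveI2) auto
  have window: "log_systole t ?L \<le> ?S" if nonneg: "0 \<le> log_systole t ?L" for t
  proof -
    obtain m where "valid_index a m" and le: "log_systole t ?L \<le> cf_local_sup a m"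
      using window_anywhere[OF assms nonneg] by blast
    then have "cf_local_sup a m \<le> ?S" by (intro cSUP_upper[OF _ bdd]) simp
    with le show ?thesis by linarith
  qed
  obtain t0 where "0 \<le> log_systole t0 ?L" using exists_log_systole_nonneg[OF L] by blast
  then have "0 \<le> ?S" using window order_trans by blast
  then have "log_systole t ?L \<le> ?S" for t using window[of t] by (cases "0 \<le> log_systole t ?L") auto
  then have "ln (mordell_constant ?L) \<le> ?S" by (rule ln_mordell_le[OF L])
  moreover have "?S \<le> ln (mordell_constant ?L)" using assms upper by (intro cSUP_least) auto
  ultimately show ?thesis by (rule antisym)
qed

theorem corollary63:
  shows "uniformly_continuous_on ({0..1} \<times> {0..1}) (\<lambda>(\<alpha>, \<beta>). local_sup \<alpha> \<beta>) \<and>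
    (\<forall>(a :: int \<Rightarrow> enat option) \<alpha> \<beta> \<Lambda>.
       cf_seq (\<lambda>i. a (int i)) \<and> cf_seq (\<lambda>i. a (- 1 - int i)) \<and>
       \<alpha> = cf_value (\<lambda>i. a (int i)) \<and> \<beta> = cf_value (\<lambda>i. a (- 1 - int i)) \<and>
       \<Lambda> = param_lattice \<alpha> \<beta> \<longrightarrow>
       ln (mordell_constant \<Lambda>) =
         (SUP n\<in>{n. cf_seq (right_seq a (n - 1)) \<and> cf_seq (left_seq a n)}.
            local_sup (alpha_cf a (n - 1)) (beta_cf a n))) \<and>
    closed mordell_gruber_spectrum"
proof (intro conjI allI impI)
  fix a :: "int \<Rightarrow> enat option" and \<alpha> \<beta> \<Lambda>
  assume *: "cf_seq (\<lambda>i. a (int i)) \<and> cf_seq (\<lambda>i. a (- 1 - int i)) \<and>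
    \<alpha> = cf_value (\<lambda>i. a (int i)) \<and> \<beta> = cf_value (\<lambda>i. a (- 1 - int i)) \<and> \<Lambda> = param_lattice \<alpha> \<beta>"
  have seqs: "right_seq a (0 - 1) = (\<lambda>i. a (int i))" "left_seq a 0 = (\<lambda>i. a (- 1 - int i))"
    by (simp_all add: right_seq_def left_seq_def)
  have "valid_index a 0" unfolding valid_index_def seqs using * by blast
  moreover have "\<Lambda> = cf_lattice a 0" unfolding alpha_cf_def beta_cf_def seqs using * by blast
  ultimately show "ln (mordell_constant \<Lambda>) =
      (SUP n\<in>{n. cf_seq (right_seq a (n - 1)) \<and> cf_seq (left_seq a n)}.
         local_sup (alpha_cf a (n - 1)) (beta_cf a n))"
    using ln_mordell_eq_SUP_local_sup unfolding valid_index_def by blast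
qed (rule uniformly_continuous_local_sup closed_mordell_gruber_spectrum)+

end
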